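(* Let $\mathbb{X}$ be an extensive restriction category which is also a classical $\perp_d$-restriction category equipped with a Kleene upper-star $\star$. Then $\mathbb{X}$ is a traced extensive restriction category with parametrized iteration operator $\mathsf{Iter}$ and trace operator $\mathsf{Tr}$ defined respectively by $$\mathsf{Iter}^X_A\big(\begin{bmatrix} f_1&f_2\end{bmatrix}\big)=f_1^\star f_2,\qquad \mathsf{Tr}^X_{A,B}(g)=g_4\sqcup g_3\,g_1^\star\,g_2,$$ for $f_1:X\to X$, $f_2:X\to A$ with $f_1\perp_d f_2$, and for $g:X+A\to X+B$ with components $g_1=\iota_1g\iota_1^\circ$, $g_2=\iota_1g\iota_2^\circ$, $g_3=\iota_2g\iota_1^\circ$, $g_4=\iota_2g\iota_2^\circ$.
   Context: Composition is diagrammatic: $fg$ means first $f$, then $g$. A restriction category is a category with an operator sending each $f:A\to B$ to $\overline{f}:A\to A$ such that $\overline{f}f=f$; $\overline{f}\,\overline{g}=\overline{g}\,\overline{f}$ and $\overline{\overline{g}f}=\overline{g}\,\overline{f}$ for $f:A\to B$, $g:A\to C$; and $f\overline{g}=\overline{fg}f$ for $f:A\to B$, $g:B\to C$. For parallel $f,g$: $f\le g$ iff $\overline{f}g=f$. A map $f:A\to B$ is total if $\overline{f}=1_A$; a restriction idempotent is a map with $\overline{e}=e$. Restriction zeroes: maps $0:A\to B$ with $f0=0=0f$ and $\overline{0}=0$. A coCartesian restriction category is a restriction category with finite coproducts whose injections $\iota_j$ are total. With restriction zeroes, the quasi-projection $\iota_j^\circ:A_1+\dots+A_n\to A_j$ is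 the unique map with $\iota_j\iota_j^\circ=1_{A_j}$ and $\iota_i\iota_j^\circ=0$ for $i\ne j$. $\nabla:A+\dots+A\to A$ is the codiagonal; copairing is written as a column. An extensive restriction category is a coCartesian restriction category with restriction zeroes such that for every $f:A\to B_1+\dots+B_n$ there is a (necessarily unique) map $\langle f\rangle:A\to A+\dots+A$ ($n$ copies) with $\overline{f}=\langle f\rangle\nabla$ and $\langle f\rangle(f+\dots+f)=f(\iota_1+\dots+\iota_n)$. A map $d:A\to A+\dots+A$ is a decision if $\langle d\rangle=d$. For $f:A\to B$, $g:A\to C$, $f\perp_d g$ iff there is a (necessarily unique) decision $\langle f\vert g\rangle:A\to A+A$ with $\langle f\vert g\rangle\iota_1^\circ=\overline{f}$, $\langle f\vert g\rangle\iota_2^\circ=\overline{g}$. This is an interference relation (symmetric, $f\perp_df\Rightarrow f=0$, $1_A\perp_d0$, downward closed for $\le$, stable under $f,g\mapsto hfk,hgk'$ and under taking restrictions) with all binary joins: for parallel $f\perp_d g:A\to B$, $f\sqcup g:=\langle f\vert g\rangle(f+g)\nabla$ is their least upper bound for $\le$, and it is preserved by precomposition. For $f\perp_d g$, $\begin{bmatrix} f&g\end{bmatrix}:=\langle f\vert g\rangle(f+g):A\to B+C$; every map $h:A\to B+C$ is uniquely of this form, with $f=h\iota_1^\circ$, $g=h\iota_2^\circ$. $\mathbb{X}$ is a classical $\perp_d$-restriction category if for all parallel $f\le g$ there is a (necessarily unique) map $g\backslash f$ with $g\backslash f\perp_d f$ and $(g\backslash f)\sqcup f=g$. For a restriction idempotent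 $e:A\to A$, $e^c:=1_A\backslash e$. A Kleene upper-star assigns to each endomorphism $f:X\to X$ an endomorphism $f^\star:X\to X$ such that: ($\star$1) $\overline{f}^{\,c}\sqcup ff^\star=f^\star$; ($\star$2) for $f:X\to Y$, $h:Y\to X$: $(hf)^\star h=h(fh)^\star\,\overline{f}^{\,c}$; ($\star$3) for $f,g:X\to X$ with $f\perp_d g$: $(f\sqcup g)^\star=(f^\star g)^\star f^\star$. A parametrized iteration operator on a category with finite coproducts is a family of operators $\mathsf{Iter}^X_A$ sending $f:X\to X+A$ to $\mathsf{Iter}^X_A(f):X\to A$ such that: [Parametrized Iteration] $f\left[\begin{smallmatrix}\mathsf{Iter}^X_A(f)\\ 1_A\end{smallmatrix}\right]=\mathsf{Iter}^X_A(f)$; [Naturality] $\mathsf{Iter}^X_A(f(1_X+h))=\mathsf{Iter}^X_{A'}(f)h$ for $f:X\to X+A'$, $h:A'\to A$; [Dinaturality] $\mathsf{Iter}^X_A(kf)=k\,\mathsf{Iter}^{X'}_A(f(k+1_A))$ for $f:X'\to X+A$, $k:X\to X'$; [Diagonal] $\mathsf{Iter}^X_A(\mathsf{Iter}^X_{X+A}(f))=\mathsf{Iter}^X_A(f(\nabla_X+1_A))$ for $f:X\to X+X+A$. A trace operator for the coproduct sends $f:X+A\to X+B$ to $\mathsf{Tr}^X_{A,B}(f):A\to B$ (associativity isomorphisms suppressed) such that: [Tightening] $\mathsf{Tr}^X((1_X+g)f(1_X+h))=g\,\mathsf{Tr}^X(f)\,h$; [Sliding] $\mathsf{Tr}^X(f(k+1_B))=\mathsf{Tr}^{X'}((k+1_A)f)$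 for $f:X+A\to X'+B$, $k:X'\to X$; [Vanishing] $\mathsf{Tr}^{X+Y}(f)=\mathsf{Tr}^Y(\mathsf{Tr}^X(f))$ for $f:X+Y+A\to X+Y+B$; [Superposing] $\mathsf{Tr}^X(f+g)=\mathsf{Tr}^X(f)+g$; [Yanking] $\mathsf{Tr}^X_{X,X}(\sigma)=1_X$ for the symmetry $\sigma:X+X\to X+X$. Known fact: trace operators and parametrized iteration operators are in bijection via $\mathsf{Tr}^X_{A,B}(f)=\iota_2f\left[\begin{smallmatrix}\mathsf{Iter}^X_B(\iota_1f)\\1_B\end{smallmatrix}\right]$ and $\mathsf{Iter}^X_B(f)=\mathsf{Tr}^X_{X,B}(\nabla_Xf)$. A traced extensive restriction category is an extensive restriction category equipped with a trace operator, equivalently a parametrized iteration operator. *)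

theory Defs
  imports Main
begin

text \<open>
  The data of a category with restriction operator, chosen finite coproducts (one for each finite
  list of objects, the empty list giving the initial object) and zero maps. Each locale below
  constrains only the fields it mentions. Composition is diagrammatic: \<open>f \<cdot> g\<close> is first \<open>f\<close>,
  then \<open>g\<close>. Injections are numbered from 0.
\<close>

record ('o, 'm) rcat =
  Obj :: "'o set"
  Arr :: "'m set"
  Dom :: "'m \<Rightarrow> 'o"
  Cod :: "'m \<Rightarrow> 'o"
  Ident :: "'o \<Rightarrow> 'm"
  Comp :: "'m \<Rightarrow> 'm \<Rightarrow> 'm" (infixl "\<cdot>\<index>" 70)
  Rst :: "'m \<Rightarrow> 'm" ("\<rho>\<index>")
  Csum :: "'o list \<Rightarrow> 'o"
  Inj :: "'o list \<Rightarrow> nat \<Rightarrow> 'm"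
  Zero :: "'o \<Rightarrow> 'o \<Rightarrow> 'm"

definition hom :: "('o, 'm, 'x) rcat_scheme \<Rightarrow> 'o \<Rightarrow> 'o \<Rightarrow> 'm set" where
  "hom C A B = {f \<in> Arr C. Dom C f = A \<and> Cod C f = B}"

locale category =
  fixes C :: "('o, 'm, 'x) rcat_scheme" (structure)
  assumes Dom_Obj: "f \<in> Arr C \<Longrightarrow> Dom C f \<in> Obj C"
    and Cod_Obj: "f \<in> Arr C \<Longrightarrow> Cod C f \<in> Obj C"
    and Id_hom: "A \<in> Obj C \<Longrightarrow> Ident C A \<in> hom C A A"
    and Comp_hom: "f \<in> hom C A B \<Longrightarrow> g \<in> hom C B D \<Longrightarrow> f \<cdot> g \<in> hom C A D"
    and Id_left: "f \<in> hom C A B \<Longrightarrow> Ident C A \<cdot> f = f"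
    and Id_right: "f \<in> hom C A B \<Longrightarrow> f \<cdot> Ident C B = f"
    and Comp_assoc: "f \<in> hom C A B \<Longrightarrow> g \<in> hom C B D \<Longrightarrow> h \<in> hom C D E \<Longrightarrow>
      (f \<cdot> g) \<cdot> h = f \<cdot> (g \<cdot> h)"


subsection \<open>Restriction categories\<close>

locale restriction_category = category C for C :: "('o, 'm, 'x) rcat_scheme" (structure) +
  assumes Rst_hom: "f \<in> hom C A B \<Longrightarrow> \<rho> f \<in> hom C A A"
    and R1: "f \<in> hom C A B \<Longrightarrow> \<rho> f \<cdot> f = f"
    and R2: "f \<in> hom C A B \<Longrightarrow> g \<in> hom C A D \<Longrightarrow> \<rho> f \<cdot> \<rho> g = \<rho> g \<cdot> \<rho> f"
    and R3: "f \<in> hom C A B \<Longrightarrow> g \<in> hom C A D \<Longrightarrow> \<rho> (\<rho> g \<cdot> f) = \<rho> g \<cdot> \<rho> f"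
    and R4: "f \<in> hom C A B \<Longrightarrow> g \<in> hom C B D \<Longrightarrow> f \<cdot> \<rho> g = \<rho> (f \<cdot> g) \<cdot> f"

definition rle :: "('o, 'm, 'x) rcat_scheme \<Rightarrow> 'm \<Rightarrow> 'm \<Rightarrow> bool" (infix "\<sqsubseteq>\<index>" 50) where
  "f \<sqsubseteq>\<^bsub>C\<^esub> g \<longleftrightarrow> f \<in> Arr C \<and> g \<in> Arr C \<and> Dom C f = Dom C g \<and> Cod C f = Cod C g \<and>
     \<rho>\<^bsub>C\<^esub> f \<cdot>\<^bsub>C\<^esub> g = f"

definition total_map :: "('o, 'm, 'x) rcat_scheme \<Rightarrow> 'm \<Rightarrow> bool" where
  "total_map C f \<longleftrightarrow> f \<in> Arr C \<and> \<rho>\<^bsub>C\<^esub> f = Ident C (Dom C f)"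

locale restriction_zeroes = restriction_category C for C :: "('o, 'm, 'x) rcat_scheme" (structure) +
  assumes Zero_hom: "A \<in> Obj C \<Longrightarrow> B \<in> Obj C \<Longrightarrow> Zero C A B \<in> hom C A B"
    and Comp_Zero: "f \<in> hom C A B \<Longrightarrow> D \<in> Obj C \<Longrightarrow> f \<cdot> Zero C B D = Zero C A D"
    and Zero_Comp: "f \<in> hom C A B \<Longrightarrow> D \<in> Obj C \<Longrightarrow> Zero C D A \<cdot> f = Zero C D B"
    and Rst_Zero: "A \<in> Obj C \<Longrightarrow> B \<in> Obj C \<Longrightarrow> \<rho> (Zero C A B) = Zero C A A"


subsection \<open>Finite coproducts\<close>

locale finite_coproducts = category C for C :: "('o, 'm, 'x) rcat_scheme" (structure) +
  assumes Csum_Obj: "set As \<subseteq> Obj C \<Longrightarrow> Csum C As \<in> Obj C"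
    and Inj_hom: "set As \<subseteq> Obj C \<Longrightarrow> i < length As \<Longrightarrow> Inj C As i \<in> hom C (As ! i) (Csum C As)"
    and Csum_universal:
      "set As \<subseteq> Obj C \<Longrightarrow> B \<in> Obj C \<Longrightarrow> length fs = length As \<Longrightarrow>
       (\<And>i. i < length As \<Longrightarrow> fs ! i \<in> hom C (As ! i) B) \<Longrightarrow>
       \<exists>!h. h \<in> hom C (Csum C As) B \<and> (\<forall>i < length As. Inj C As i \<cdot> h = fs ! i)"

definition cotuple :: "('o, 'm, 'x) rcat_scheme \<Rightarrow> 'o \<Rightarrow> 'm list \<Rightarrow> 'm" where
  "cotuple C B fs = (THE h. h \<in> hom C (Csum C (map (Dom C) fs)) B \<and>
     (\<forall>i < length fs. Inj C (map (Dom C) fs) i \<cdot>\<^bsub>C\<^esub> h = fs ! i))"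

text \<open>The map \<open>f\<^sub>1 + \<dots> + f\<^sub>n\<close>.\<close>

definition sum_maps :: "('o, 'm, 'x) rcat_scheme \<Rightarrow> 'm list \<Rightarrow> 'm" where
  "sum_maps C fs = cotuple C (Csum C (map (Cod C) fs))
     (map (\<lambda>i. fs ! i \<cdot>\<^bsub>C\<^esub> Inj C (map (Cod C) fs) i) [0..<length fs])"

definition codiag :: "('o, 'm, 'x) rcat_scheme \<Rightarrow> nat \<Rightarrow> 'o \<Rightarrow> 'm" where
  "codiag C n A = cotuple C A (replicate n (Ident C A))"

abbreviation bsum :: "('o, 'm, 'x) rcat_scheme \<Rightarrow> 'o \<Rightarrow> 'o \<Rightarrow> 'o" (infixr "\<oplus>\<index>" 65) where
  "A \<oplus>\<^bsub>C\<^esub> B \<equiv> Csum C [A, B]"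

abbreviation bsum_map :: "('o, 'm, 'x) rcat_scheme \<Rightarrow> 'm \<Rightarrow> 'm \<Rightarrow> 'm" (infixr "\<boxplus>\<index>" 65) where
  "f \<boxplus>\<^bsub>C\<^esub> g \<equiv> sum_maps C [f, g]"

abbreviation copair :: "('o, 'm, 'x) rcat_scheme \<Rightarrow> 'm \<Rightarrow> 'm \<Rightarrow> 'm" where
  "copair C f g \<equiv> cotuple C (Cod C f) [f, g]"

definition assoc :: "('o, 'm, 'x) rcat_scheme \<Rightarrow> 'o \<Rightarrow> 'o \<Rightarrow> 'o \<Rightarrow> 'm" where
  "assoc C X Y Z = copair C
     (Inj C [X, Y] 0 \<cdot>\<^bsub>C\<^esub> Inj C [X \<oplus>\<^bsub>C\<^esub> Y, Z] 0)
     (copair C (Inj C [X, Y] 1 \<cdot>\<^bsub>C\<^esub> Inj C [X \<oplus>\<^bsub>C\<^esub> Y, Z] 0) (Inj C [X \<oplus>\<^bsub>C\<^esub> Y, Z] 1))"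
    \<comment> \<open>\<open>X + (Y + Z) \<rightarrow> (X + Y) + Z\<close>\<close>

definition unassoc :: "('o, 'm, 'x) rcat_scheme \<Rightarrow> 'o \<Rightarrow> 'o \<Rightarrow> 'o \<Rightarrow> 'm" where
  "unassoc C X Y Z = copair C
     (copair C (Inj C [X, Y \<oplus>\<^bsub>C\<^esub> Z] 0) (Inj C [Y, Z] 0 \<cdot>\<^bsub>C\<^esub> Inj C [X, Y \<oplus>\<^bsub>C\<^esub> Z] 1))
     (Inj C [Y, Z] 1 \<cdot>\<^bsub>C\<^esub> Inj C [X, Y \<oplus>\<^bsub>C\<^esub> Z] 1)"
    \<comment> \<open>\<open>(X + Y) + Z \<rightarrow> X + (Y + Z)\<close>\<close>

definition symm :: "('o, 'm, 'x) rcat_scheme \<Rightarrow> 'o \<Rightarrow> 'o \<Rightarrow> 'm" where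
  "symm C X Y = copair C (Inj C [Y, X] 1) (Inj C [Y, X] 0)"


subsection \<open>Extensive restriction categories\<close>

locale cocartesian_restriction_category =
  restriction_category C + finite_coproducts C for C :: "('o, 'm, 'x) rcat_scheme" (structure) +
  assumes Inj_total: "set As \<subseteq> Obj C \<Longrightarrow> i < length As \<Longrightarrow> total_map C (Inj C As i)"

definition qproj :: "('o, 'm, 'x) rcat_scheme \<Rightarrow> 'o list \<Rightarrow> nat \<Rightarrow> 'm" where
  "qproj C As j = cotuple C (As ! j)
     (map (\<lambda>i. if i = j then Ident C (As ! j) else Zero C (As ! i) (As ! j)) [0..<length As])"

definition decides :: "('o, 'm, 'x) rcat_scheme \<Rightarrow> 'o list \<Rightarrow> 'm \<Rightarrow> 'm \<Rightarrow> bool" where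
  "decides C Bs f d \<longleftrightarrow>
     (let n = length Bs; A = Dom C f in
       d \<in> hom C A (Csum C (replicate n A)) \<and>
       \<rho>\<^bsub>C\<^esub> f = d \<cdot>\<^bsub>C\<^esub> codiag C n A \<and>
       d \<cdot>\<^bsub>C\<^esub> sum_maps C (replicate n f) = f \<cdot>\<^bsub>C\<^esub> sum_maps C (map (Inj C Bs) [0..<n]))"

locale extensive_restriction_category =
  cocartesian_restriction_category C + restriction_zeroes C for C :: "('o, 'm, 'x) rcat_scheme" (structure) +
  assumes extensive: "set Bs \<subseteq> Obj C \<Longrightarrow> f \<in> hom C A (Csum C Bs) \<Longrightarrow> \<exists>d. decides C Bs f d"

text \<open>
  The map \<open>\<langle>f\<rangle>\<close> for \<open>f : A \<rightarrow> B\<^sub>1 + \<dots> + B\<^sub>n\<close>. The summands \<open>Bs\<close> are an argument, since they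
  are not determined by the object \<open>Csum C Bs\<close>.
\<close>

definition dec :: "('o, 'm, 'x) rcat_scheme \<Rightarrow> 'o list \<Rightarrow> 'm \<Rightarrow> 'm" where
  "dec C Bs f = (THE d. decides C Bs f d)"

definition decision :: "('o, 'm, 'x) rcat_scheme \<Rightarrow> nat \<Rightarrow> 'o \<Rightarrow> 'm \<Rightarrow> bool" where
  "decision C n A d \<longleftrightarrow> d \<in> hom C A (Csum C (replicate n A)) \<and> dec C (replicate n A) d = d"


subsection \<open>Decision separation, joins and relative complements\<close>

definition separates :: "('o, 'm, 'x) rcat_scheme \<Rightarrow> 'm \<Rightarrow> 'm \<Rightarrow> 'm \<Rightarrow> bool" where
  "separates C f g d \<longleftrightarrow>
     (let A = Dom C f in
       decision C 2 A d \<and> d \<cdot>\<^bsub>C\<^esub> qproj C [A, A] 0 = \<rho>\<^bsub>C\<^esub> f \<and> d \<cdot>\<^bsub>C\<^esub> qproj C [A, A] 1 = \<rho>\<^bsub>C\<^esub> g)"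

definition perp_d :: "('o, 'm, 'x) rcat_scheme \<Rightarrow> 'm \<Rightarrow> 'm \<Rightarrow> bool" (infix "\<bottom>\<index>" 50) where
  "f \<bottom>\<^bsub>C\<^esub> g \<longleftrightarrow> f \<in> Arr C \<and> g \<in> Arr C \<and> Dom C f = Dom C g \<and> (\<exists>d. separates C f g d)"

text \<open>The decision \<open>\<langle>f|g\<rangle>\<close>, meaningful when \<open>f \<bottom> g\<close>.\<close>

definition sep :: "('o, 'm, 'x) rcat_scheme \<Rightarrow> 'm \<Rightarrow> 'm \<Rightarrow> 'm" where
  "sep C f g = (THE d. separates C f g d)"

text \<open>The row \<open>[f g] : A \<rightarrow> B + C\<close> of \<open>f : A \<rightarrow> B\<close> and \<open>g : A \<rightarrow> C\<close> with \<open>f \<bottom> g\<close>.\<close>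

definition row :: "('o, 'm, 'x) rcat_scheme \<Rightarrow> 'm \<Rightarrow> 'm \<Rightarrow> 'm" where
  "row C f g = sep C f g \<cdot>\<^bsub>C\<^esub> (f \<boxplus>\<^bsub>C\<^esub> g)"

definition djoin :: "('o, 'm, 'x) rcat_scheme \<Rightarrow> 'm \<Rightarrow> 'm \<Rightarrow> 'm" (infixl "\<squnion>\<index>" 65) where
  "f \<squnion>\<^bsub>C\<^esub> g = sep C f g \<cdot>\<^bsub>C\<^esub> (f \<boxplus>\<^bsub>C\<^esub> g) \<cdot>\<^bsub>C\<^esub> codiag C 2 (Cod C f)"

definition is_rel_compl :: "('o, 'm, 'x) rcat_scheme \<Rightarrow> 'm \<Rightarrow> 'm \<Rightarrow> 'm \<Rightarrow> bool" where
  "is_rel_compl C g f h \<longleftrightarrow>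
     h \<in> hom C (Dom C g) (Cod C g) \<and> h \<bottom>\<^bsub>C\<^esub> f \<and> h \<squnion>\<^bsub>C\<^esub> f = g"

locale classical_extensive_restriction_category = extensive_restriction_category C
  for C :: "('o, 'm, 'x) rcat_scheme" (structure) +
  assumes classical: "f \<sqsubseteq> g \<Longrightarrow> \<exists>h. is_rel_compl C g f h"

definition rel_compl :: "('o, 'm, 'x) rcat_scheme \<Rightarrow> 'm \<Rightarrow> 'm \<Rightarrow> 'm" where
  "rel_compl C g f = (THE h. is_rel_compl C g f h)"

definition compl :: "('o, 'm, 'x) rcat_scheme \<Rightarrow> 'm \<Rightarrow> 'm" where
  "compl C e = rel_compl C (Ident C (Dom C e)) e"


subsection \<open>Kleene upper-stars, iteration and trace\<close>

locale kleene_upper_star = classical_extensive_restriction_category C for C :: "('o, 'm, 'x) rcat_scheme" (structure) +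
  fixes star :: "'m \<Rightarrow> 'm"
  assumes star_hom: "f \<in> hom C X X \<Longrightarrow> star f \<in> hom C X X"
    and star1: "f \<in> hom C X X \<Longrightarrow> compl C (\<rho> f) \<squnion> f \<cdot> star f = star f"
    and star2: "f \<in> hom C X Y \<Longrightarrow> h \<in> hom C Y X \<Longrightarrow>
      star (h \<cdot> f) \<cdot> h = h \<cdot> star (f \<cdot> h) \<cdot> compl C (\<rho> f)"
    and star3: "f \<in> hom C X X \<Longrightarrow> g \<in> hom C X X \<Longrightarrow> f \<bottom> g \<Longrightarrow>
      star (f \<squnion> g) = star (star f \<cdot> g) \<cdot> star f"

text \<open>
  \<open>Iter X A f\<close> stands for \<open>Iter\<^sup>X\<^sub>A(f)\<close> and \<open>Tr X A B f\<close> for \<open>Tr\<^sup>X\<^sub>A\<^sub>B(f)\<close>. Coproducts of three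
  objects are bracketed and the associativity isomorphisms are written out.
\<close>

locale parametrized_iteration_operator = finite_coproducts C for C :: "('o, 'm, 'x) rcat_scheme" (structure) +
  fixes Iter :: "'o \<Rightarrow> 'o \<Rightarrow> 'm \<Rightarrow> 'm"
  assumes Iter_hom:
      "X \<in> Obj C \<Longrightarrow> A \<in> Obj C \<Longrightarrow> f \<in> hom C X (X \<oplus> A) \<Longrightarrow> Iter X A f \<in> hom C X A"
    and parametrized_iteration:
      "X \<in> Obj C \<Longrightarrow> A \<in> Obj C \<Longrightarrow> f \<in> hom C X (X \<oplus> A) \<Longrightarrow>
       f \<cdot> copair C (Iter X A f) (Ident C A) = Iter X A f"
    and naturality:
      "X \<in> Obj C \<Longrightarrow> A' \<in> Obj C \<Longrightarrow> f \<in> hom C X (X \<oplus> A') \<Longrightarrow> h \<in> hom C A' A \<Longrightarrow>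
       Iter X A (f \<cdot> (Ident C X \<boxplus> h)) = Iter X A' f \<cdot> h"
    and dinaturality:
      "X \<in> Obj C \<Longrightarrow> A \<in> Obj C \<Longrightarrow> f \<in> hom C X' (X \<oplus> A) \<Longrightarrow> k \<in> hom C X X' \<Longrightarrow>
       Iter X A (k \<cdot> f) = k \<cdot> Iter X' A (f \<cdot> (k \<boxplus> Ident C A))"
    and diagonal:
      "X \<in> Obj C \<Longrightarrow> A \<in> Obj C \<Longrightarrow> f \<in> hom C X (X \<oplus> X \<oplus> A) \<Longrightarrow>
       Iter X A (Iter X (X \<oplus> A) f) = Iter X A (f \<cdot> assoc C X X A \<cdot> (codiag C 2 X \<boxplus> Ident C A))"

locale trace_operator = finite_coproducts C for C :: "('o, 'm, 'x) rcat_scheme" (structure) +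
  fixes Tr :: "'o \<Rightarrow> 'o \<Rightarrow> 'o \<Rightarrow> 'm \<Rightarrow> 'm"
  assumes Tr_hom:
      "X \<in> Obj C \<Longrightarrow> A \<in> Obj C \<Longrightarrow> B \<in> Obj C \<Longrightarrow> f \<in> hom C (X \<oplus> A) (X \<oplus> B) \<Longrightarrow>
       Tr X A B f \<in> hom C A B"
    and tightening:
      "X \<in> Obj C \<Longrightarrow> f \<in> hom C (X \<oplus> A) (X \<oplus> B) \<Longrightarrow> g \<in> hom C A' A \<Longrightarrow> h \<in> hom C B B' \<Longrightarrow>
       Tr X A' B' ((Ident C X \<boxplus> g) \<cdot> f \<cdot> (Ident C X \<boxplus> h)) = g \<cdot> Tr X A B f \<cdot> h"
    and sliding:
      "A \<in> Obj C \<Longrightarrow> B \<in> Obj C \<Longrightarrow> f \<in> hom C (X \<oplus> A) (X' \<oplus> B) \<Longrightarrow> k \<in> hom C X' X \<Longrightarrow>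
       Tr X A B (f \<cdot> (k \<boxplus> Ident C B)) = Tr X' A B ((k \<boxplus> Ident C A) \<cdot> f)"
    and vanishing:
      "X \<in> Obj C \<Longrightarrow> Y \<in> Obj C \<Longrightarrow> A \<in> Obj C \<Longrightarrow> B \<in> Obj C \<Longrightarrow>
       f \<in> hom C (X \<oplus> Y \<oplus> A) (X \<oplus> Y \<oplus> B) \<Longrightarrow>
       Tr (X \<oplus> Y) A B (unassoc C X Y A \<cdot> f \<cdot> assoc C X Y B) =
       Tr Y A B (Tr X (Y \<oplus> A) (Y \<oplus> B) f)"
    and superposing:
      "X \<in> Obj C \<Longrightarrow> A \<in> Obj C \<Longrightarrow> B \<in> Obj C \<Longrightarrow>
       f \<in> hom C (X \<oplus> A) (X \<oplus> B) \<Longrightarrow> g \<in> hom C D E \<Longrightarrow>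
       Tr X (A \<oplus> D) (B \<oplus> E) (assoc C X A D \<cdot> (f \<boxplus> g) \<cdot> unassoc C X B E) = Tr X A B f \<boxplus> g"
    and yanking: "X \<in> Obj C \<Longrightarrow> Tr X X X (symm C X X) = Ident C X"

locale traced_extensive_restriction_category =
  extensive_restriction_category C + trace_operator C Tr for C :: "('o, 'm, 'x) rcat_scheme" (structure) and Tr

text \<open>The two mutually inverse passages between trace and parametrized iteration operators.\<close>

definition corresponding ::
    "('o, 'm, 'x) rcat_scheme \<Rightarrow> ('o \<Rightarrow> 'o \<Rightarrow> 'm \<Rightarrow> 'm) \<Rightarrow> ('o \<Rightarrow> 'o \<Rightarrow> 'o \<Rightarrow> 'm \<Rightarrow> 'm) \<Rightarrow> bool" where
  "corresponding C Iter Tr \<longleftrightarrow>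
     (\<forall>X \<in> Obj C. \<forall>A \<in> Obj C. \<forall>B \<in> Obj C. \<forall>f \<in> hom C (X \<oplus>\<^bsub>C\<^esub> A) (X \<oplus>\<^bsub>C\<^esub> B).
        Tr X A B f = Inj C [X, A] 1 \<cdot>\<^bsub>C\<^esub> f \<cdot>\<^bsub>C\<^esub> copair C (Iter X B (Inj C [X, A] 0 \<cdot>\<^bsub>C\<^esub> f)) (Ident C B)) \<and>
     (\<forall>X \<in> Obj C. \<forall>B \<in> Obj C. \<forall>f \<in> hom C X (X \<oplus>\<^bsub>C\<^esub> B).
        Iter X B f = Tr X X B (codiag C 2 X \<cdot>\<^bsub>C\<^esub> f))"

text \<open>
  Every \<open>f : X \<rightarrow> X + A\<close> is uniquely of the form \<open>[f\<^sub>1 f\<^sub>2]\<close>, its entries being the composites of \<open>f\<close>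
  with the quasi-projections.
\<close>

definition star_iter ::
    "('o, 'm, 'x) rcat_scheme \<Rightarrow> ('m \<Rightarrow> 'm) \<Rightarrow> 'o \<Rightarrow> 'o \<Rightarrow> 'm \<Rightarrow> 'm" where
  "star_iter C star X A f =
     star (f \<cdot>\<^bsub>C\<^esub> qproj C [X, A] 0) \<cdot>\<^bsub>C\<^esub> (f \<cdot>\<^bsub>C\<^esub> qproj C [X, A] 1)"

definition star_trace ::
    "('o, 'm, 'x) rcat_scheme \<Rightarrow> ('m \<Rightarrow> 'm) \<Rightarrow> 'o \<Rightarrow> 'o \<Rightarrow> 'o \<Rightarrow> 'm \<Rightarrow> 'm" where
  "star_trace C star X A B g =
     (let g1 = Inj C [X, A] 0 \<cdot>\<^bsub>C\<^esub> g \<cdot>\<^bsub>C\<^esub> qproj C [X, B] 0;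
          g2 = Inj C [X, A] 0 \<cdot>\<^bsub>C\<^esub> g \<cdot>\<^bsub>C\<^esub> qproj C [X, B] 1;
          g3 = Inj C [X, A] 1 \<cdot>\<^bsub>C\<^esub> g \<cdot>\<^bsub>C\<^esub> qproj C [X, B] 0;
          g4 = Inj C [X, A] 1 \<cdot>\<^bsub>C\<^esub> g \<cdot>\<^bsub>C\<^esub> qproj C [X, B] 1
      in g4 \<squnion>\<^bsub>C\<^esub> g3 \<cdot>\<^bsub>C\<^esub> star g1 \<cdot>\<^bsub>C\<^esub> g2)"

end

theory Submission
  imports Defs
begin

text \<open>
  A map into a binary coproduct is determined by its composites with the quasi-projections, and
  \<open>f \<bottom> g\<close> holds iff \<open>f\<close> and \<open>g\<close> are the two components of such a map \<open>h\<close>; their join is then \<open>h\<nabla>\<close>.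
  In terms of components the iteration axioms are the axioms of the star: if \<open>f\<^sub>1 \<bottom> f\<^sub>2\<close>, then the
  complement of the domain of \<open>f\<^sub>1\<close> acts trivially on \<open>f\<^sub>2\<close>, so that the first star axiom gives the
  fixpoint equation, the second one dinaturality, and the third one the diagonal axiom. The trace is the one
  associated with the iteration operator; its vanishing axiom follows from Bekic's identity.
\<close>

section \<open>Binary coproducts\<close>

text \<open>The coproduct axioms govern maps out of a sum, while separation, rows and joins concern
  maps into one. Extensivity bridges the two, but it is assumed only as the existence of a decision
  for each map. Uniqueness of decisions and of complements has to be derived before the descriptions
  behind \<open>dec\<close>, \<open>sep\<close> and \<open>rel_compl\<close> can be used. The danger
  is a circle: joint monicity of the quasi-projections would give uniqueness of decisions, yet its
  proof has to compare decisions. The way out is that a decision \<open>d\<close> satisfies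
  \<open>\<rho> d = d \<cdot> codiag C 2 A\<close>, so that two decisions with equal components can
  be compared in the restriction order, where antisymmetry finishes. That composition distributes
  over joins is likewise computed, with a map representing the separated pair.\<close>

context category
begin

lemma homD:
  "f \<in> hom C A B \<Longrightarrow> f \<in> Arr C \<and> Dom C f = A \<and> Cod C f = B \<and> A \<in> Obj C \<and> B \<in> Obj C"
  by (auto simp: hom_def Dom_Obj Cod_Obj)

lemma homI: "f \<in> Arr C \<Longrightarrow> Dom C f = A \<Longrightarrow> Cod C f = B \<Longrightarrow> f \<in> hom C A B"
  by (simp add: hom_def)

lemma Comp_simps [simp]:
  assumes "f \<in> Arr C" "g \<in> Arr C" "Cod C f = Dom C g"
  shows "f \<cdot> g \<in> Arr C" "Dom C (f \<cdot> g) = Dom C f" "Cod C (f \<cdot> g) = Cod C g"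
  using Comp_hom[of f "Dom C f" "Cod C f" g "Cod C g"] assms by (simp_all add: hom_def)

text \<open>As a simp rule it nests composites to the right, which is why cancellation laws come in
  a second form with a trailing factor, such as \<open>Inj_copair_Comp\<close>. Typing is split into
  conditions on \<open>Arr\<close>, \<open>Dom\<close> and \<open>Cod\<close>, which rewriting can
  discharge without guessing endpoints.\<close>

lemma Comp_assoc_Arr [simp]:
  assumes "f \<in> Arr C" "g \<in> Arr C" "h \<in> Arr C" "Cod C f = Dom C g" "Cod C g = Dom C h"
  shows "f \<cdot> g \<cdot> h = f \<cdot> (g \<cdot> h)"
  using assms by (intro Comp_assoc) (auto simp: hom_def)

lemma Ident_simps [simp]:
  assumes "A \<in> Obj C"
  shows "Ident C A \<in> Arr C" "Dom C (Ident C A) = A" "Cod C (Ident C A) = A"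
  using Id_hom[OF assms] by (simp_all add: hom_def)

lemma Ident_left [simp]: "f \<in> Arr C \<Longrightarrow> Dom C f = A \<Longrightarrow> Ident C A \<cdot> f = f"
  by (rule Id_left) (simp add: hom_def)

lemma Ident_right [simp]: "f \<in> Arr C \<Longrightarrow> Cod C f = A \<Longrightarrow> f \<cdot> Ident C A = f"
  by (rule Id_right) (simp add: hom_def)

lemma Obj_simps [simp]:
  "f \<in> Arr C \<Longrightarrow> Dom C f \<in> Obj C" "f \<in> Arr C \<Longrightarrow> Cod C f \<in> Obj C"
  by (simp_all add: Dom_Obj Cod_Obj)

end

context finite_coproducts
begin

abbreviation (input) \<iota>\<^sub>0 where "\<iota>\<^sub>0 A B \<equiv> Inj C [A, B] 0"
abbreviation (input) \<iota>\<^sub>1 where "\<iota>\<^sub>1 A B \<equiv> Inj C [A, B] (Suc 0)"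

lemma Inj_simps [simp]:
  assumes "A \<in> Obj C" "B \<in> Obj C"
  shows "A \<oplus> B \<in> Obj C"
    "\<iota>\<^sub>0 A B \<in> Arr C" "Dom C (\<iota>\<^sub>0 A B) = A" "Cod C (\<iota>\<^sub>0 A B) = A \<oplus> B"
    "\<iota>\<^sub>1 A B \<in> Arr C" "Dom C (\<iota>\<^sub>1 A B) = B" "Cod C (\<iota>\<^sub>1 A B) = A \<oplus> B"
  using Inj_hom[of "[A, B]" 0] Inj_hom[of "[A, B]" 1] Csum_Obj[of "[A, B]"] assms
  by (simp_all add: hom_def)

lemma copair_spec:
  assumes "f \<in> Arr C" "g \<in> Arr C" "Cod C f = D" "Cod C g = D"
  shows "cotuple C D [f, g] \<in> hom C (Dom C f \<oplus> Dom C g) D \<and>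
    \<iota>\<^sub>0 (Dom C f) (Dom C g) \<cdot> cotuple C D [f, g] = f \<and>
    \<iota>\<^sub>1 (Dom C f) (Dom C g) \<cdot> cotuple C D [f, g] = g"
proof -
  have "\<exists>!h. h \<in> hom C (Dom C f \<oplus> Dom C g) D \<and>
      (\<forall>i < length [Dom C f, Dom C g]. Inj C [Dom C f, Dom C g] i \<cdot> h = [f, g] ! i)"
    using assms by (intro Csum_universal) (auto simp: hom_def less_Suc_eq nth_Cons')
  from theI'[OF this] show ?thesis
    by (auto simp: cotuple_def less_Suc_eq all_conj_distrib)
qed

lemma copair_simps [simp]:
  assumes "f \<in> Arr C" "g \<in> Arr C" "Cod C f = D" "Cod C g = D"
  shows "cotuple C D [f, g] \<in> Arr C" "Dom C (cotuple C D [f, g]) = Dom C f \<oplus> Dom C g"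
    "Cod C (cotuple C D [f, g]) = D"
  using copair_spec[OF assms] by (simp_all add: hom_def)

lemma Inj_copair [simp]:
  assumes "f \<in> Arr C" "g \<in> Arr C" "Cod C f = D" "Cod C g = D" "Dom C f = A" "Dom C g = B"
  shows "\<iota>\<^sub>0 A B \<cdot> cotuple C D [f, g] = f" "\<iota>\<^sub>1 A B \<cdot> cotuple C D [f, g] = g"
  using copair_spec[OF assms(1-4)] assms(5,6) by simp_all

lemma Inj_copair_Comp [simp]:
  assumes "f \<in> Arr C" "g \<in> Arr C" "Cod C f = D" "Cod C g = D" "Dom C f = A" "Dom C g = B"
    and "h \<in> Arr C" "Dom C h = D"
  shows "\<iota>\<^sub>0 A B \<cdot> (cotuple C D [f, g] \<cdot> h) = f \<cdot> h" "\<iota>\<^sub>1 A B \<cdot> (cotuple C D [f, g] \<cdot> h) = g \<cdot> h"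
  using Comp_assoc_Arr[of "\<iota>\<^sub>0 A B" "cotuple C D [f, g]" h]
    Comp_assoc_Arr[of "\<iota>\<^sub>1 A B" "cotuple C D [f, g]" h] assms
  by (auto simp del: Comp_assoc_Arr)

lemma coproduct_eqI:
  assumes h: "h \<in> Arr C" "Dom C h = A \<oplus> B" and k: "k \<in> Arr C" "Dom C k = A \<oplus> B"
    and "Cod C h = Cod C k" and AB: "A \<in> Obj C" "B \<in> Obj C"
    and eq: "\<iota>\<^sub>0 A B \<cdot> h = \<iota>\<^sub>0 A B \<cdot> k" "\<iota>\<^sub>1 A B \<cdot> h = \<iota>\<^sub>1 A B \<cdot> k"
  shows "h = k"
proof -
  have "\<exists>!l. l \<in> hom C (A \<oplus> B) (Cod C k) \<and>
      (\<forall>i < length [A, B]. Inj C [A, B] i \<cdot> l = [\<iota>\<^sub>0 A B \<cdot> k, \<iota>\<^sub>1 A B \<cdot> k] ! i)"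
    using assms by (intro Csum_universal) (auto simp: hom_def less_Suc_eq nth_Cons')
  moreover have "h \<in> hom C (A \<oplus> B) (Cod C k)" "k \<in> hom C (A \<oplus> B) (Cod C k)"
    using assms by (simp_all add: hom_def)
  ultimately show ?thesis
    using eq by (auto simp: less_Suc_eq elim!: ex1E)
qed

lemma copair_Comp:
  assumes "f \<in> Arr C" "g \<in> Arr C" "Cod C f = D" "Cod C g = D" "h \<in> Arr C" "Dom C h = D"
  shows "cotuple C D [f, g] \<cdot> h = cotuple C (Cod C h) [f \<cdot> h, g \<cdot> h]"
  by (rule coproduct_eqI[of _ "Dom C f" "Dom C g"]) (use assms in simp_all)

lemma sum_map_eq_copair:
  "f \<boxplus> g = cotuple C (Cod C f \<oplus> Cod C g) [f \<cdot> \<iota>\<^sub>0 (Cod C f) (Cod C g), g \<cdot> \<iota>\<^sub>1 (Cod C f) (Cod C g)]"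
  by (simp add: sum_maps_def)

lemma sum_map_simps [simp]:
  assumes "f \<in> Arr C" "g \<in> Arr C"
  shows "f \<boxplus> g \<in> Arr C" "Dom C (f \<boxplus> g) = Dom C f \<oplus> Dom C g" "Cod C (f \<boxplus> g) = Cod C f \<oplus> Cod C g"
  using assms by (simp_all add: sum_map_eq_copair)

lemma Inj_sum_map [simp]:
  assumes "f \<in> Arr C" "g \<in> Arr C" "Dom C f = A" "Dom C g = B"
  shows "\<iota>\<^sub>0 A B \<cdot> (f \<boxplus> g) = f \<cdot> \<iota>\<^sub>0 (Cod C f) (Cod C g)"
    "\<iota>\<^sub>1 A B \<cdot> (f \<boxplus> g) = g \<cdot> \<iota>\<^sub>1 (Cod C f) (Cod C g)"
  using assms by (simp_all add: sum_map_eq_copair)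

lemma Inj_sum_map_Comp [simp]:
  assumes "f \<in> Arr C" "g \<in> Arr C" "Dom C f = A" "Dom C g = B"
    and "h \<in> Arr C" "Dom C h = Cod C f \<oplus> Cod C g"
  shows "\<iota>\<^sub>0 A B \<cdot> ((f \<boxplus> g) \<cdot> h) = f \<cdot> (\<iota>\<^sub>0 (Cod C f) (Cod C g) \<cdot> h)"
    "\<iota>\<^sub>1 A B \<cdot> ((f \<boxplus> g) \<cdot> h) = g \<cdot> (\<iota>\<^sub>1 (Cod C f) (Cod C g) \<cdot> h)"
  using assms by (simp_all add: sum_map_eq_copair)

lemma sum_map_copair [simp]:
  assumes "f \<in> Arr C" "g \<in> Arr C" "a \<in> Arr C" "b \<in> Arr C" "Cod C a = D" "Cod C b = D"
    and "Cod C f = Dom C a" "Cod C g = Dom C b"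
  shows "(f \<boxplus> g) \<cdot> cotuple C D [a, b] = cotuple C D [f \<cdot> a, g \<cdot> b]"
  by (rule coproduct_eqI[of _ "Dom C f" "Dom C g"]) (use assms in simp_all)

lemma codiag_eq_copair: "codiag C 2 A = cotuple C A [Ident C A, Ident C A]"
  by (simp add: codiag_def numeral_2_eq_2)

lemma assoc_simps [simp]:
  assumes "X \<in> Obj C" "Y \<in> Obj C" "Z \<in> Obj C"
  shows "assoc C X Y Z \<in> Arr C" "Dom C (assoc C X Y Z) = X \<oplus> Y \<oplus> Z"
    "Cod C (assoc C X Y Z) = (X \<oplus> Y) \<oplus> Z"
  using assms by (simp_all add: assoc_def)

lemma unassoc_simps [simp]:
  assumes "X \<in> Obj C" "Y \<in> Obj C" "Z \<in> Obj C"
  shows "unassoc C X Y Z \<in> Arr C" "Dom C (unassoc C X Y Z) = (X \<oplus> Y) \<oplus> Z"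
    "Cod C (unassoc C X Y Z) = X \<oplus> Y \<oplus> Z"
  using assms by (simp_all add: unassoc_def)

end

section \<open>Trace operators from iteration operators\<close>

context parametrized_iteration_operator
begin

lemma Iter_simps [simp]:
  assumes "f \<in> Arr C" "Dom C f = X" "Cod C f = X \<oplus> A" "A \<in> Obj C"
  shows "Iter X A f \<in> Arr C" "Dom C (Iter X A f) = X" "Cod C (Iter X A f) = A"
  using Iter_hom[of X A f] assms by (auto simp: hom_def)

lemma Iter_fixpoint:
  assumes "f \<in> Arr C" "Dom C f = X" "Cod C f = X \<oplus> A" "A \<in> Obj C"
  shows "f \<cdot> cotuple C A [Iter X A f, Ident C A] = Iter X A f"
  using parametrized_iteration[of X A f] assms by (auto simp: hom_def)

text \<open>When the body of a loop on \<open>Z\<close> returns only through \<open>k\<close>, the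
  loop may be run on \<open>X\<close> instead: unroll once by the fixpoint equation, then move
  \<open>k\<close> across by dinaturality. Both stages of Bekic's identity are instances, with
  \<open>k\<close> an injection.\<close>

lemma Iter_summand:
  assumes Z: "Z \<in> Obj C" and A: "A \<in> Obj C" and h: "h \<in> hom C Z (X \<oplus> A)" and k: "k \<in> hom C X Z"
  shows "Iter Z A (h \<cdot> (k \<boxplus> Ident C A)) = h \<cdot> cotuple C A [Iter X A (k \<cdot> h), Ident C A]"
proof -
  note [simp] = Z A homD[OF h] homD[OF k]
  let ?I = "Iter Z A (h \<cdot> (k \<boxplus> Ident C A))"
  have "?I = h \<cdot> (k \<boxplus> Ident C A) \<cdot> cotuple C A [?I, Ident C A]"
    by (rule Iter_fixpoint[symmetric]) simp_all
  also have "\<dots> = h \<cdot> cotuple C A [k \<cdot> ?I, Ident C A]"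
    by simp
  also have "k \<cdot> ?I = Iter X A (k \<cdot> h)"
    by (rule dinaturality[symmetric]) (use h k in simp_all)
  finally show ?thesis .
qed

text \<open>
  Bekic's identity. The loop over \<open>X + Y\<close> is split by the diagonal axiom into an inner loop through
  \<open>X\<close> and an outer loop through \<open>Y\<close>.
\<close>

lemma Iter_sum:
  assumes XYB: "X \<in> Obj C" "Y \<in> Obj C" "B \<in> Obj C"
    and h: "h \<in> hom C (X \<oplus> Y) (X \<oplus> Y \<oplus> B)"
  defines "p \<equiv> h \<cdot> cotuple C (Y \<oplus> B) [Iter X (Y \<oplus> B) (\<iota>\<^sub>0 X Y \<cdot> h), Ident C (Y \<oplus> B)]"
  shows "Iter (X \<oplus> Y) B (h \<cdot> assoc C X Y B) = p \<cdot> cotuple C B [Iter Y B (\<iota>\<^sub>1 X Y \<cdot> p), Ident C B]"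
proof -
  note [simp] = XYB homD[OF h]
  let ?Z = "X \<oplus> Y"
  have p [simp]: "p \<in> Arr C" "Dom C p = ?Z" "Cod C p = Y \<oplus> B"
    by (simp_all add: p_def)
  \<comment> \<open>Jumps to \<open>X\<close> go to one copy of \<open>X \<oplus> Y\<close> and
    jumps to \<open>Y\<close> to a second one; merging the two copies gives back the original body,
    as the diagonal axiom requires.\<close>
  let ?H' = "h \<cdot> (\<iota>\<^sub>0 X Y \<boxplus> Ident C (Y \<oplus> B))"
  let ?H = "?H' \<cdot> (Ident C ?Z \<boxplus> (\<iota>\<^sub>1 X Y \<boxplus> Ident C B))"
  have "h \<cdot> assoc C X Y B = ?H \<cdot> assoc C ?Z ?Z B \<cdot> (codiag C 2 ?Z \<boxplus> Ident C B)"
    by (simp add: assoc_def codiag_eq_copair copair_Comp sum_map_eq_copair)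
  then have "Iter ?Z B (h \<cdot> assoc C X Y B) = Iter ?Z B (Iter ?Z (?Z \<oplus> B) ?H)"
    by (subst diagonal) (simp_all add: homI)
  also have "Iter ?Z (?Z \<oplus> B) ?H = Iter ?Z (Y \<oplus> B) ?H' \<cdot> (\<iota>\<^sub>1 X Y \<boxplus> Ident C B)"
    by (rule naturality) (simp_all add: homI)
  also have "Iter ?Z (Y \<oplus> B) ?H' = p"
    unfolding p_def by (rule Iter_summand) (use h in \<open>simp_all add: homI\<close>)
  also have "Iter ?Z B (p \<cdot> (\<iota>\<^sub>1 X Y \<boxplus> Ident C B)) =
      p \<cdot> cotuple C B [Iter Y B (\<iota>\<^sub>1 X Y \<cdot> p), Ident C B]"
    by (rule Iter_summand) (simp_all add: homI)
  finally show ?thesis .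
qed

text \<open>Tightening comes from naturality, sliding from dinaturality, superposing from naturality
  along an injection, and yanking from one unrolling. The trace is characterised by an equation
  rather than defined, so that the lemma applies to an operator given by another formula.\<close>

lemma trace_operatorI:
  assumes Tr: "\<And>X A B f. X \<in> Obj C \<Longrightarrow> A \<in> Obj C \<Longrightarrow> B \<in> Obj C \<Longrightarrow>
    f \<in> hom C (X \<oplus> A) (X \<oplus> B) \<Longrightarrow>
    Tr X A B f = \<iota>\<^sub>1 X A \<cdot> f \<cdot> cotuple C B [Iter X B (\<iota>\<^sub>0 X A \<cdot> f), Ident C B]"
  shows "trace_operator C Tr"
proof
  fix X A B f
  assume "X \<in> Obj C" "A \<in> Obj C" "B \<in> Obj C" and f: "f \<in> hom C (X \<oplus> A) (X \<oplus> B)"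
  note [simp] = this(1-3) homD[OF f]
  show "Tr X A B f \<in> hom C A B"
    by (simp add: Tr f homI)
next
  fix X f A B g A' h B'
  assume "X \<in> Obj C" and f: "f \<in> hom C (X \<oplus> A) (X \<oplus> B)"
    and g: "g \<in> hom C A' A" and h: "h \<in> hom C B B'"
  note [simp] = this(1) homD[OF f] homD[OF g] homD[OF h]
  have nat: "Iter X B' (\<iota>\<^sub>0 X A \<cdot> (f \<cdot> (Ident C X \<boxplus> h))) = Iter X B (\<iota>\<^sub>0 X A \<cdot> f) \<cdot> h"
    using naturality[of X B "\<iota>\<^sub>0 X A \<cdot> f" h B'] h by (simp add: homI)
  show "Tr X A' B' ((Ident C X \<boxplus> g) \<cdot> f \<cdot> (Ident C X \<boxplus> h)) = g \<cdot> Tr X A B f \<cdot> h"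
    by (simp add: Tr f homI nat copair_Comp)
next
  fix A B f X X' k
  assume "A \<in> Obj C" "B \<in> Obj C" and f: "f \<in> hom C (X \<oplus> A) (X' \<oplus> B)" and k: "k \<in> hom C X' X"
  note [simp] = this(1,2) homD[OF f] homD[OF k]
  have din: "Iter X' B (k \<cdot> (\<iota>\<^sub>0 X A \<cdot> f)) = k \<cdot> Iter X B (\<iota>\<^sub>0 X A \<cdot> (f \<cdot> (k \<boxplus> Ident C B)))"
    using dinaturality[of X' B "\<iota>\<^sub>0 X A \<cdot> f" X k] by (simp add: homI)
  show "Tr X A B (f \<cdot> (k \<boxplus> Ident C B)) = Tr X' A B ((k \<boxplus> Ident C A) \<cdot> f)"
    by (simp add: Tr homI din)
next
  fix X Y A B f
  assume "X \<in> Obj C" "Y \<in> Obj C" "A \<in> Obj C" "B \<in> Obj C"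
    and f: "f \<in> hom C (X \<oplus> Y \<oplus> A) (X \<oplus> Y \<oplus> B)"
  note [simp] = this(1-4) homD[OF f]
  \<comment> \<open>Both sides of vanishing reduce to \<open>f \<cdot> (u \<cdot> v)\<close> entered
    from \<open>A\<close>: \<open>u\<close> runs the finished \<open>X\<close>-loop \<open>a\<close>
    wherever \<open>X\<close> is reached, \<open>c\<close> is the body of the \<open>Y\<close>-loop
    that remains, and \<open>v\<close> runs its iterate \<open>w\<close>.\<close>
  define a where "a = Iter X (Y \<oplus> B) (\<iota>\<^sub>0 X (Y \<oplus> A) \<cdot> f)"
  have [simp]: "a \<in> Arr C" "Dom C a = X" "Cod C a = Y \<oplus> B"
    by (simp_all add: a_def)
  define u where "u = cotuple C (Y \<oplus> B) [a, Ident C (Y \<oplus> B)]"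
  have [simp]: "u \<in> Arr C" "Dom C u = X \<oplus> Y \<oplus> B" "Cod C u = Y \<oplus> B"
    by (simp_all add: u_def)
  define c where "c = \<iota>\<^sub>0 Y A \<cdot> (\<iota>\<^sub>1 X (Y \<oplus> A) \<cdot> (f \<cdot> u))"
  have [simp]: "c \<in> Arr C" "Dom C c = Y" "Cod C c = Y \<oplus> B"
    by (simp_all add: c_def)
  define w where "w = Iter Y B c"
  have [simp]: "w \<in> Arr C" "Dom C w = Y" "Cod C w = B"
    by (simp_all add: w_def)
  define v where "v = cotuple C B [w, Ident C B]"
  have [simp]: "v \<in> Arr C" "Dom C v = Y \<oplus> B" "Cod C v = B"
    by (simp_all add: v_def)
  have cv: "c \<cdot> v = w"
    unfolding v_def w_def by (rule Iter_fixpoint) simp_all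
  have a: "\<iota>\<^sub>0 X (Y \<oplus> A) \<cdot> (f \<cdot> u) = a"
    using Iter_fixpoint[of "\<iota>\<^sub>0 X (Y \<oplus> A) \<cdot> f" X "Y \<oplus> B"] by (simp add: u_def a_def)
  \<comment> \<open>The part of \<open>f\<close> that starts in \<open>X\<close> or
    \<open>Y\<close>, without \<open>A\<close>: the body of the joint loop, in the shape that
    \<open>Iter_sum\<close> expects.\<close>
  define h where
    "h = cotuple C (X \<oplus> Y \<oplus> B) [\<iota>\<^sub>0 X (Y \<oplus> A) \<cdot> f, \<iota>\<^sub>0 Y A \<cdot> (\<iota>\<^sub>1 X (Y \<oplus> A) \<cdot> f)]"
  have [simp]: "h \<in> Arr C" "Dom C h = X \<oplus> Y" "Cod C h = X \<oplus> Y \<oplus> B"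
    by (simp_all add: h_def)
  have h0: "Iter X (Y \<oplus> B) (\<iota>\<^sub>0 X Y \<cdot> h) = a"
    by (simp add: h_def a_def)
  have hu: "h \<cdot> u = cotuple C (Y \<oplus> B) [a, c]"
    by (simp add: h_def copair_Comp a c_def)
  have "Iter (X \<oplus> Y) B (h \<cdot> assoc C X Y B) = cotuple C (Y \<oplus> B) [a, c] \<cdot> v"
    using Iter_sum[of X Y B h] by (simp add: homI h0 hu flip: u_def w_def v_def)
  then have bekic: "Iter (X \<oplus> Y) B (h \<cdot> assoc C X Y B) = cotuple C B [a \<cdot> v, w]"
    by (simp add: copair_Comp cv)
  have i1: "\<iota>\<^sub>1 (X \<oplus> Y) A \<cdot> (unassoc C X Y A \<cdot> l) = \<iota>\<^sub>1 Y A \<cdot> (\<iota>\<^sub>1 X (Y \<oplus> A) \<cdot> l)"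
    if "l \<in> Arr C" "Dom C l = X \<oplus> Y \<oplus> A" for l
    using that by (simp add: unassoc_def)
  have i0: "\<iota>\<^sub>0 (X \<oplus> Y) A \<cdot> (unassoc C X Y A \<cdot> (f \<cdot> assoc C X Y B)) = h \<cdot> assoc C X Y B"
    by (simp add: unassoc_def h_def copair_Comp)
  have ac: "assoc C X Y B \<cdot> cotuple C B [cotuple C B [a \<cdot> v, w], Ident C B] = u \<cdot> v"
    by (simp add: assoc_def copair_Comp u_def v_def)
  have "Tr (X \<oplus> Y) A B (unassoc C X Y A \<cdot> f \<cdot> assoc C X Y B) =
      \<iota>\<^sub>1 Y A \<cdot> (\<iota>\<^sub>1 X (Y \<oplus> A) \<cdot> (f \<cdot> (u \<cdot> v)))"
    by (subst Tr) (simp_all add: homI i0 i1 bekic ac)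
  also have "\<dots> = Tr Y A B (\<iota>\<^sub>1 X (Y \<oplus> A) \<cdot> (f \<cdot> u))"
    by (subst Tr) (simp_all add: homI flip: c_def w_def v_def)
  also have "\<iota>\<^sub>1 X (Y \<oplus> A) \<cdot> (f \<cdot> u) = Tr X (Y \<oplus> A) (Y \<oplus> B) f"
    by (simp add: Tr f u_def a_def)
  finally show "Tr (X \<oplus> Y) A B (unassoc C X Y A \<cdot> f \<cdot> assoc C X Y B) =
      Tr Y A B (Tr X (Y \<oplus> A) (Y \<oplus> B) f)" .
next
  fix X A B f g D E
  assume "X \<in> Obj C" "A \<in> Obj C" "B \<in> Obj C"
    and f: "f \<in> hom C (X \<oplus> A) (X \<oplus> B)" and g: "g \<in> hom C D E"
  note [simp] = this(1-3) homD[OF f] homD[OF g]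
  let ?F = "assoc C X A D \<cdot> (f \<boxplus> g) \<cdot> unassoc C X B E"
  have u: "cotuple C (X \<oplus> B \<oplus> E) [\<iota>\<^sub>0 X (B \<oplus> E), \<iota>\<^sub>0 B E \<cdot> \<iota>\<^sub>1 X (B \<oplus> E)] =
      Ident C X \<boxplus> \<iota>\<^sub>0 B E"
    by (simp add: sum_map_eq_copair)
  \<comment> \<open>Entered from \<open>X\<close>, the loop never meets \<open>g\<close>;
    \<open>?F\<close> differs from \<open>f\<close> there only by the larger exit object
    \<open>B \<oplus> E\<close>, which naturality handles.\<close>
  have F0: "\<iota>\<^sub>0 X (A \<oplus> D) \<cdot> ?F = \<iota>\<^sub>0 X A \<cdot> f \<cdot> (Ident C X \<boxplus> \<iota>\<^sub>0 B E)"
    by (simp add: assoc_def unassoc_def u)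
  have nat: "Iter X (B \<oplus> E) (\<iota>\<^sub>0 X A \<cdot> f \<cdot> (Ident C X \<boxplus> \<iota>\<^sub>0 B E)) = Iter X B (\<iota>\<^sub>0 X A \<cdot> f) \<cdot> \<iota>\<^sub>0 B E"
    by (rule naturality) (simp_all add: homI)
  have F1: "\<iota>\<^sub>1 X (A \<oplus> D) \<cdot> ?F =
      cotuple C (X \<oplus> B \<oplus> E) [\<iota>\<^sub>1 X A \<cdot> f \<cdot> (Ident C X \<boxplus> \<iota>\<^sub>0 B E), g \<cdot> (\<iota>\<^sub>1 B E \<cdot> \<iota>\<^sub>1 X (B \<oplus> E))]"
    by (simp add: assoc_def unassoc_def u copair_Comp)
  have "Tr X (A \<oplus> D) (B \<oplus> E) ?F = (\<iota>\<^sub>1 X (A \<oplus> D) \<cdot> ?F) \<cdot>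
      cotuple C (B \<oplus> E) [Iter X (B \<oplus> E) (\<iota>\<^sub>0 X (A \<oplus> D) \<cdot> ?F), Ident C (B \<oplus> E)]"
    by (rule Tr) (simp_all add: homI)
  also have "\<dots> = cotuple C (B \<oplus> E) [\<iota>\<^sub>1 X A \<cdot> f \<cdot> cotuple C B [Iter X B (\<iota>\<^sub>0 X A \<cdot> f), Ident C B] \<cdot> \<iota>\<^sub>0 B E,
      g \<cdot> \<iota>\<^sub>1 B E]"
    unfolding F0 F1 nat by (simp add: copair_Comp)
  also have "\<dots> = Tr X A B f \<boxplus> g"
    by (simp add: Tr f homI sum_map_eq_copair)
  finally show "Tr X (A \<oplus> D) (B \<oplus> E) ?F = Tr X A B f \<boxplus> g" .
next
  fix X assume [simp]: "X \<in> Obj C"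
  \<comment> \<open>The symmetry sends the loop summand straight to the exit, so one unrolling
    computes the iterate.\<close>
  have "Iter X X (\<iota>\<^sub>1 X X) = \<iota>\<^sub>1 X X \<cdot> cotuple C X [Iter X X (\<iota>\<^sub>1 X X), Ident C X]"
    by (rule Iter_fixpoint[symmetric]) simp_all
  then show "Tr X X X (symm C X X) = Ident C X"
    by (simp add: Tr homI symm_def)
qed

end

section \<open>Decision separation and joins\<close>

context restriction_category
begin

lemma Rst_simps [simp]:
  assumes "f \<in> Arr C"
  shows "\<rho> f \<in> Arr C" "Dom C (\<rho> f) = Dom C f" "Cod C (\<rho> f) = Dom C f"
  using Rst_hom[of f "Dom C f" "Cod C f"] assms by (simp_all add: hom_def)

lemma Rst_Comp_self [simp]: "f \<in> Arr C \<Longrightarrow> \<rho> f \<cdot> f = f"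
  by (rule R1) (simp add: hom_def)

lemma Rst_Comp_self_Comp [simp]:
  "f \<in> Arr C \<Longrightarrow> h \<in> Arr C \<Longrightarrow> Cod C f = Dom C h \<Longrightarrow> \<rho> f \<cdot> (f \<cdot> h) = f \<cdot> h"
  using Comp_assoc_Arr[of "\<rho> f" f h] by (simp del: Comp_assoc_Arr)

lemma Rst_commute: "f \<in> Arr C \<Longrightarrow> g \<in> Arr C \<Longrightarrow> Dom C f = Dom C g \<Longrightarrow> \<rho> f \<cdot> \<rho> g = \<rho> g \<cdot> \<rho> f"
  by (rule R2) (auto simp: hom_def)

lemma Rst_Rst_Comp:
  "f \<in> Arr C \<Longrightarrow> g \<in> Arr C \<Longrightarrow> Dom C f = Dom C g \<Longrightarrow> \<rho> (\<rho> g \<cdot> f) = \<rho> g \<cdot> \<rho> f"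
  by (rule R3) (auto simp: hom_def)

lemma Comp_Rst: "f \<in> Arr C \<Longrightarrow> g \<in> Arr C \<Longrightarrow> Cod C f = Dom C g \<Longrightarrow> f \<cdot> \<rho> g = \<rho> (f \<cdot> g) \<cdot> f"
  by (rule R4) (auto simp: hom_def)

lemma Rst_Ident [simp]:
  assumes "A \<in> Obj C"
  shows "\<rho> (Ident C A) = Ident C A"
  using Rst_Comp_self[of "Ident C A"] assms by (simp del: Rst_Comp_self)

lemma Rst_Rst [simp]: "f \<in> Arr C \<Longrightarrow> \<rho> (\<rho> f) = \<rho> f"
  using Rst_Rst_Comp[of "Ident C (Dom C f)" f] by simp

lemma Rst_idem_Comp [simp]:
  "f \<in> Arr C \<Longrightarrow> h \<in> Arr C \<Longrightarrow> Dom C f = Dom C h \<Longrightarrow> \<rho> f \<cdot> (\<rho> f \<cdot> h) = \<rho> f \<cdot> h"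
  using Rst_Comp_self_Comp[of "\<rho> f" h] by simp

text \<open>Totality of \<open>g\<close> gives \<open>\<rho> (f \<cdot> g) \<cdot> f = f\<close>, so
  the domain of \<open>f\<close> lies below that of \<open>f \<cdot> g\<close>; the other comparison
  holds for any \<open>g\<close>.\<close>

lemma Rst_Comp_total:
  assumes [simp]: "f \<in> Arr C" "g \<in> Arr C" "Cod C f = Dom C g" and "\<rho> g = Ident C (Dom C g)"
  shows "\<rho> (f \<cdot> g) = \<rho> f"
proof -
  have "\<rho> (f \<cdot> g) \<cdot> f = f"
    using Comp_Rst[of f g] assms by simp
  then have "\<rho> f = \<rho> (f \<cdot> g) \<cdot> \<rho> f"
    using Rst_Rst_Comp[of f "f \<cdot> g"] by simp
  also have "\<dots> = \<rho> f \<cdot> \<rho> (f \<cdot> g)"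
    by (rule Rst_commute) simp_all
  also have "\<dots> = \<rho> (\<rho> f \<cdot> (f \<cdot> g))"
    by (rule Rst_Rst_Comp[symmetric]) simp_all
  finally show ?thesis
    by simp
qed

lemma rle_antisym:
  assumes "f \<sqsubseteq> g" "g \<sqsubseteq> f"
  shows "f = g"
proof -
  have [simp]: "f \<in> Arr C" "g \<in> Arr C" "Dom C f = Dom C g" "Cod C f = Cod C g"
    and fg: "\<rho> f \<cdot> g = f" and gf: "\<rho> g \<cdot> f = g"
    using assms by (simp_all add: rle_def)
  have "f = (\<rho> f \<cdot> \<rho> g) \<cdot> f"
    by (simp add: fg gf)
  also have "\<rho> f \<cdot> \<rho> g = \<rho> g \<cdot> \<rho> f"
    by (rule Rst_commute) simp_all
  finally show ?thesis
    by (simp add: gf)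
qed

end

section \<open>Zero maps and quasi-projections\<close>

context extensive_restriction_category
begin

abbreviation (input) \<pi>\<^sub>0 where "\<pi>\<^sub>0 A B \<equiv> qproj C [A, B] 0"
abbreviation (input) \<pi>\<^sub>1 where "\<pi>\<^sub>1 A B \<equiv> qproj C [A, B] (Suc 0)"

lemma Zero_simps [simp]:
  assumes "A \<in> Obj C" "B \<in> Obj C"
  shows "Zero C A B \<in> Arr C" "Dom C (Zero C A B) = A" "Cod C (Zero C A B) = B"
    "\<rho> (Zero C A B) = Zero C A A"
  using Zero_hom[OF assms] Rst_Zero[OF assms] by (simp_all add: hom_def)

lemma Comp_Zero_Arr [simp]:
  "f \<in> Arr C \<Longrightarrow> Cod C f = B \<Longrightarrow> D \<in> Obj C \<Longrightarrow> f \<cdot> Zero C B D = Zero C (Dom C f) D"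
  by (rule Comp_Zero) (simp_all add: hom_def)

lemma Zero_Comp_Arr [simp]:
  "f \<in> Arr C \<Longrightarrow> Dom C f = A \<Longrightarrow> D \<in> Obj C \<Longrightarrow> Zero C D A \<cdot> f = Zero C D (Cod C f)"
  by (rule Zero_Comp) (simp_all add: hom_def)

lemma Rst_Inj [simp]:
  assumes "A \<in> Obj C" "B \<in> Obj C"
  shows "\<rho> (\<iota>\<^sub>0 A B) = Ident C A" "\<rho> (\<iota>\<^sub>1 A B) = Ident C B"
  using Inj_total[of "[A, B]" 0] Inj_total[of "[A, B]" 1] assms by (simp_all add: total_map_def)

lemma qproj_eq_copair:
  "\<pi>\<^sub>0 A B = cotuple C A [Ident C A, Zero C B A]" "\<pi>\<^sub>1 A B = cotuple C B [Zero C A B, Ident C B]"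
  by (simp_all add: qproj_def)

lemma qproj_simps [simp]:
  assumes "A \<in> Obj C" "B \<in> Obj C"
  shows "\<pi>\<^sub>0 A B \<in> Arr C" "Dom C (\<pi>\<^sub>0 A B) = A \<oplus> B" "Cod C (\<pi>\<^sub>0 A B) = A"
    "\<pi>\<^sub>1 A B \<in> Arr C" "Dom C (\<pi>\<^sub>1 A B) = A \<oplus> B" "Cod C (\<pi>\<^sub>1 A B) = B"
    "\<iota>\<^sub>0 A B \<cdot> \<pi>\<^sub>0 A B = Ident C A" "\<iota>\<^sub>0 A B \<cdot> \<pi>\<^sub>1 A B = Zero C A B"
    "\<iota>\<^sub>1 A B \<cdot> \<pi>\<^sub>0 A B = Zero C B A" "\<iota>\<^sub>1 A B \<cdot> \<pi>\<^sub>1 A B = Ident C B"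
  using assms by (simp_all add: qproj_eq_copair)

lemma Inj_qproj_Comp [simp]:
  assumes "f \<in> Arr C" "Dom C f = A" "B \<in> Obj C"
  shows "\<iota>\<^sub>0 A B \<cdot> (\<pi>\<^sub>0 A B \<cdot> f) = f" "\<iota>\<^sub>0 B A \<cdot> (\<pi>\<^sub>1 B A \<cdot> f) = Zero C B (Cod C f)"
    "\<iota>\<^sub>1 A B \<cdot> (\<pi>\<^sub>0 A B \<cdot> f) = Zero C B (Cod C f)" "\<iota>\<^sub>1 B A \<cdot> (\<pi>\<^sub>1 B A \<cdot> f) = f"
  using assms by (auto simp: qproj_eq_copair)

lemma sum_map_qproj [simp]:
  assumes "f \<in> Arr C" "g \<in> Arr C" "Cod C f = A" "Cod C g = B"
  shows "(f \<boxplus> g) \<cdot> \<pi>\<^sub>0 A B = \<pi>\<^sub>0 (Dom C f) (Dom C g) \<cdot> f"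
    "(f \<boxplus> g) \<cdot> \<pi>\<^sub>1 A B = \<pi>\<^sub>1 (Dom C f) (Dom C g) \<cdot> g"
  by (rule coproduct_eqI[of _ "Dom C f" "Dom C g"];
      use assms in \<open>auto simp: qproj_eq_copair\<close>)+

lemma codiag_simps [simp]:
  assumes "A \<in> Obj C"
  shows "codiag C 2 A \<in> Arr C" "Dom C (codiag C 2 A) = A \<oplus> A" "Cod C (codiag C 2 A) = A"
    "\<iota>\<^sub>0 A A \<cdot> codiag C 2 A = Ident C A" "\<iota>\<^sub>1 A A \<cdot> codiag C 2 A = Ident C A"
  using assms by (simp_all add: codiag_eq_copair)

lemma sum_map_codiag:
  assumes "f \<in> Arr C" "g \<in> Arr C" "Cod C f = A" "Cod C g = A"
  shows "(f \<boxplus> g) \<cdot> codiag C 2 A = cotuple C A [f, g]"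
  using assms by (auto simp: codiag_eq_copair)

text \<open>A quasi-projection is the codiagonal cut down to one summand: precomposed with an
  injection, its domain becomes that of an identity or of a zero map. This ties the components of a
  decision \<open>d\<close> to \<open>d \<cdot> codiag C 2 A\<close>, which the definition equates
  with a domain.\<close>

lemma Rst_qproj_codiag:
  assumes [simp]: "A \<in> Obj C"
  shows "\<rho> (\<pi>\<^sub>0 A A) \<cdot> codiag C 2 A = \<pi>\<^sub>0 A A" "\<rho> (\<pi>\<^sub>1 A A) \<cdot> codiag C 2 A = \<pi>\<^sub>1 A A"
proof -
  have *: "i \<cdot> (\<rho> q \<cdot> codiag C 2 A) = \<rho> (i \<cdot> q) \<cdot> (i \<cdot> codiag C 2 A)"
    if "i \<in> Arr C" "q \<in> Arr C" "Cod C i = A \<oplus> A" "Dom C q = A \<oplus> A" for i q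
    using that Comp_assoc_Arr[of i "\<rho> q" "codiag C 2 A"] Comp_Rst[of i q]
      Comp_assoc_Arr[of "\<rho> (i \<cdot> q)" i "codiag C 2 A"]
    by (simp del: Comp_assoc_Arr)
  show "\<rho> (\<pi>\<^sub>0 A A) \<cdot> codiag C 2 A = \<pi>\<^sub>0 A A"
    by (rule coproduct_eqI[of _ A A]) (simp_all add: *)
  show "\<rho> (\<pi>\<^sub>1 A A) \<cdot> codiag C 2 A = \<pi>\<^sub>1 A A"
    by (rule coproduct_eqI[of _ A A]) (simp_all add: *)
qed

section \<open>Decisions of maps into a binary coproduct\<close>

lemma decides_binary:
  "decides C [B, D] f d \<longleftrightarrow> d \<in> hom C (Dom C f) (Dom C f \<oplus> Dom C f) \<and>
     \<rho> f = d \<cdot> codiag C 2 (Dom C f) \<and> d \<cdot> (f \<boxplus> f) = f \<cdot> (\<iota>\<^sub>0 B D \<boxplus> \<iota>\<^sub>1 B D)"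
  by (simp add: decides_def numeral_2_eq_2 Let_def)

text \<open>The defining equations of a decision read through the quasi-projections. The last part
  recovers \<open>f\<close> from its decision and its components, which is what makes maps into a
  coproduct comparable.\<close>

lemma decides_qproj:
  assumes f: "f \<in> hom C A (B \<oplus> D)" and [simp]: "B \<in> Obj C" "D \<in> Obj C"
    and dec: "decides C [B, D] f d"
  shows "d \<cdot> \<pi>\<^sub>0 A A = \<rho> (f \<cdot> \<pi>\<^sub>0 B D)" "d \<cdot> \<pi>\<^sub>1 A A = \<rho> (f \<cdot> \<pi>\<^sub>1 B D)"
    "\<rho> (f \<cdot> \<pi>\<^sub>0 B D) \<cdot> f = f \<cdot> (\<pi>\<^sub>0 B D \<cdot> \<iota>\<^sub>0 B D)" "\<rho> (f \<cdot> \<pi>\<^sub>1 B D) \<cdot> f = f \<cdot> (\<pi>\<^sub>1 B D \<cdot> \<iota>\<^sub>1 B D)"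
    "d \<cdot> (f \<cdot> \<pi>\<^sub>0 B D \<boxplus> f \<cdot> \<pi>\<^sub>1 B D) = f"
proof -
  note [simp] = homD[OF f]
  have d: "d \<in> hom C A (A \<oplus> A)" and rst: "d \<cdot> codiag C 2 A = \<rho> f"
    and sum: "d \<cdot> (f \<boxplus> f) = f \<cdot> (\<iota>\<^sub>0 B D \<boxplus> \<iota>\<^sub>1 B D)"
    using dec by (simp_all add: decides_binary)
  note [simp] = homD[OF d]
  \<comment> \<open>One argument serves both summands: \<open>q\<close> is a quasi-projection of
    \<open>A \<oplus> A\<close>, \<open>q'\<close> the matching one of \<open>B \<oplus> D\<close>,
    and \<open>i\<close> its section.\<close>
  have comp: "d \<cdot> q = \<rho> (f \<cdot> q')" "\<rho> (f \<cdot> q') \<cdot> f = f \<cdot> (q' \<cdot> i)"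
    if [simp]: "q \<in> Arr C" "Dom C q = A \<oplus> A" "Cod C q = A"
      "q' \<in> Arr C" "Dom C q' = B \<oplus> D" "i \<in> Arr C" "Dom C i = Cod C q'" "Cod C i = B \<oplus> D"
      and q: "\<rho> q \<cdot> codiag C 2 A = q" and qf: "d \<cdot> (q \<cdot> f) = f \<cdot> (q' \<cdot> i)"
      and i: "\<rho> i = Ident C (Cod C q')" for q q' i
  proof -
    have "d \<cdot> q = (d \<cdot> \<rho> q) \<cdot> codiag C 2 A"
      by (simp add: q)
    also have "\<dots> = \<rho> (d \<cdot> q) \<cdot> \<rho> f"
      by (simp add: Comp_Rst[of d q] rst)
    finally have dq: "d \<cdot> q = \<rho> (d \<cdot> q) \<cdot> \<rho> f" .
    have "\<rho> (d \<cdot> q) = \<rho> (\<rho> (d \<cdot> q) \<cdot> \<rho> f)"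
      by (rule arg_cong[OF dq])
    also have "\<dots> = \<rho> (d \<cdot> q) \<cdot> \<rho> f"
      by (simp add: Rst_Rst_Comp)
    also have "\<dots> = d \<cdot> q"
      by (rule dq[symmetric])
    finally have *: "\<rho> (d \<cdot> q) = d \<cdot> q" .
    \<comment> \<open>Appending the total map \<open>i\<close> leaves the domain unchanged and
      produces the composite to which \<open>qf\<close> applies.\<close>
    have "\<rho> (f \<cdot> q') = \<rho> (f \<cdot> q' \<cdot> i)"
      by (rule Rst_Comp_total[symmetric]) (simp_all add: i)
    also have "\<dots> = \<rho> (\<rho> (d \<cdot> q) \<cdot> f)"
      by (simp add: * qf)
    also have "\<dots> = d \<cdot> q"
      by (subst Rst_Rst_Comp) (simp_all flip: dq)
    finally show dq': "d \<cdot> q = \<rho> (f \<cdot> q')" ..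
    show "\<rho> (f \<cdot> q') \<cdot> f = f \<cdot> (q' \<cdot> i)"
      by (simp add: qf flip: dq')
  qed
  have "d \<cdot> (f \<boxplus> f) \<cdot> \<pi>\<^sub>0 (B \<oplus> D) (B \<oplus> D) = f \<cdot> (\<iota>\<^sub>0 B D \<boxplus> \<iota>\<^sub>1 B D) \<cdot> \<pi>\<^sub>0 (B \<oplus> D) (B \<oplus> D)"
    "d \<cdot> (f \<boxplus> f) \<cdot> \<pi>\<^sub>1 (B \<oplus> D) (B \<oplus> D) = f \<cdot> (\<iota>\<^sub>0 B D \<boxplus> \<iota>\<^sub>1 B D) \<cdot> \<pi>\<^sub>1 (B \<oplus> D) (B \<oplus> D)"
    by (simp_all only: sum)
  then have qf: "d \<cdot> (\<pi>\<^sub>0 A A \<cdot> f) = f \<cdot> (\<pi>\<^sub>0 B D \<cdot> \<iota>\<^sub>0 B D)"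
      "d \<cdot> (\<pi>\<^sub>1 A A \<cdot> f) = f \<cdot> (\<pi>\<^sub>1 B D \<cdot> \<iota>\<^sub>1 B D)"
    by simp_all
  show "d \<cdot> \<pi>\<^sub>0 A A = \<rho> (f \<cdot> \<pi>\<^sub>0 B D)" "\<rho> (f \<cdot> \<pi>\<^sub>0 B D) \<cdot> f = f \<cdot> (\<pi>\<^sub>0 B D \<cdot> \<iota>\<^sub>0 B D)"
    by (rule comp[of "\<pi>\<^sub>0 A A" _ "\<iota>\<^sub>0 B D"]; simp add: Rst_qproj_codiag qf)+
  show "d \<cdot> \<pi>\<^sub>1 A A = \<rho> (f \<cdot> \<pi>\<^sub>1 B D)" "\<rho> (f \<cdot> \<pi>\<^sub>1 B D) \<cdot> f = f \<cdot> (\<pi>\<^sub>1 B D \<cdot> \<iota>\<^sub>1 B D)"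
    by (rule comp[of "\<pi>\<^sub>1 A A" _ "\<iota>\<^sub>1 B D"]; simp add: Rst_qproj_codiag qf)+
  have "d \<cdot> (f \<cdot> \<pi>\<^sub>0 B D \<boxplus> f \<cdot> \<pi>\<^sub>1 B D) = d \<cdot> (f \<boxplus> f) \<cdot> (\<pi>\<^sub>0 B D \<boxplus> \<pi>\<^sub>1 B D)"
    by (simp add: sum_map_eq_copair copair_Comp)
  also have "\<dots> = f \<cdot> (\<iota>\<^sub>0 B D \<boxplus> \<iota>\<^sub>1 B D) \<cdot> (\<pi>\<^sub>0 B D \<boxplus> \<pi>\<^sub>1 B D)"
    by (simp only: sum)
  also have "\<dots> = f \<cdot> ((\<iota>\<^sub>0 B D \<boxplus> \<iota>\<^sub>1 B D) \<cdot> (\<pi>\<^sub>0 B D \<boxplus> \<pi>\<^sub>1 B D))"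
    by simp
  also have "(\<iota>\<^sub>0 B D \<boxplus> \<iota>\<^sub>1 B D) \<cdot> (\<pi>\<^sub>0 B D \<boxplus> \<pi>\<^sub>1 B D) = Ident C (B \<oplus> D)"
    by (rule coproduct_eqI[of _ B D]) simp_all
  finally show "d \<cdot> (f \<cdot> \<pi>\<^sub>0 B D \<boxplus> f \<cdot> \<pi>\<^sub>1 B D) = f"
    by simp
qed

lemma decides_exists: "f \<in> hom C A (B \<oplus> D) \<Longrightarrow> B \<in> Obj C \<Longrightarrow> D \<in> Obj C \<Longrightarrow> \<exists>d. decides C [B, D] f d"
  by (rule extensive) auto

text \<open>
  If \<open>e\<close> decides \<open>d\<close> and \<open>c\<close> decides \<open>e\<close>, then all three have the same components, so both \<open>d\<close> and \<open>e\<close>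
  end in the idempotent \<open>s\<close> formed from these, which forces \<open>d = e\<close>.
\<close>

lemma decides_self:
  assumes A [simp]: "A \<in> Obj C" and d: "d \<in> hom C A (A \<oplus> A)"
    and idem: "\<rho> (d \<cdot> \<pi>\<^sub>0 A A) = d \<cdot> \<pi>\<^sub>0 A A" "\<rho> (d \<cdot> \<pi>\<^sub>1 A A) = d \<cdot> \<pi>\<^sub>1 A A"
  shows "decides C [A, A] d d"
proof -
  note [simp] = homD[OF d]
  obtain e where e: "decides C [A, A] d e"
    using decides_exists[OF d] by auto
  then have e_hom: "e \<in> hom C A (A \<oplus> A)"
    by (simp add: decides_binary)
  obtain c where c: "decides C [A, A] e c"
    using decides_exists[OF e_hom] by auto
  then have c_hom: "c \<in> hom C A (A \<oplus> A)"
    using homD[OF e_hom] by (simp add: decides_binary)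
  note [simp] = homD[OF e_hom] homD[OF c_hom]
  define s where "s = d \<cdot> \<pi>\<^sub>0 A A \<boxplus> d \<cdot> \<pi>\<^sub>1 A A"
  have [simp]: "s \<in> Arr C" "Dom C s = A \<oplus> A" "Cod C s = A \<oplus> A"
    by (simp_all add: s_def)
  have "\<rho> (d \<cdot> \<pi>\<^sub>0 A A) \<boxplus> \<rho> (d \<cdot> \<pi>\<^sub>1 A A) = s"
    unfolding idem s_def ..
  moreover have "(\<rho> (d \<cdot> \<pi>\<^sub>0 A A) \<boxplus> \<rho> (d \<cdot> \<pi>\<^sub>1 A A)) \<cdot> (\<rho> (d \<cdot> \<pi>\<^sub>0 A A) \<boxplus> \<rho> (d \<cdot> \<pi>\<^sub>1 A A)) =
      \<rho> (d \<cdot> \<pi>\<^sub>0 A A) \<boxplus> \<rho> (d \<cdot> \<pi>\<^sub>1 A A)"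
    by (rule coproduct_eqI[of _ A A]) simp_all
  ultimately have ss: "s \<cdot> s = s"
    by simp
  have es: "e \<cdot> s = d"
    using decides_qproj(5)[OF d A A e] by (simp add: s_def)
  have "e \<cdot> \<pi>\<^sub>0 A A = d \<cdot> \<pi>\<^sub>0 A A" "e \<cdot> \<pi>\<^sub>1 A A = d \<cdot> \<pi>\<^sub>1 A A"
    using decides_qproj(1,2)[OF d A A e] idem by simp_all
  then have cs: "c \<cdot> s = e"
    using decides_qproj(5)[OF e_hom A A c] by (simp add: s_def)
  have "d = c \<cdot> s \<cdot> s"
    by (simp only: cs es)
  also have "\<dots> = c \<cdot> (s \<cdot> s)"
    by (rule Comp_assoc_Arr) simp_all
  also have "\<dots> = e"
    by (simp only: ss cs)
  finally have "d = e" .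
  with e show ?thesis
    by simp
qed

text \<open>By symmetry it suffices that \<open>d\<close> lies below \<open>d'\<close>. Since
  \<open>\<rho> d = d \<cdot> codiag C 2 A\<close>, the map \<open>\<rho> d \<cdot> d'\<close> is
  \<open>d\<close> followed by the column of \<open>e0 \<cdot> d'\<close> and
  \<open>e1 \<cdot> d'\<close>; on \<open>e0\<close> the map \<open>d'\<close> is the first
  injection, on \<open>e1\<close> the second.\<close>

lemma decision_unique:
  assumes A: "A \<in> Obj C" and d: "d \<in> hom C A (A \<oplus> A)" and d': "d' \<in> hom C A (A \<oplus> A)"
    and idem: "\<rho> (d \<cdot> \<pi>\<^sub>0 A A) = d \<cdot> \<pi>\<^sub>0 A A" "\<rho> (d \<cdot> \<pi>\<^sub>1 A A) = d \<cdot> \<pi>\<^sub>1 A A"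
    and eq: "d \<cdot> \<pi>\<^sub>0 A A = d' \<cdot> \<pi>\<^sub>0 A A" "d \<cdot> \<pi>\<^sub>1 A A = d' \<cdot> \<pi>\<^sub>1 A A"
  shows "d = d'"
proof -
  have le: "d \<sqsubseteq> d'" if d: "d \<in> hom C A (A \<oplus> A)" and d': "d' \<in> hom C A (A \<oplus> A)"
    and idem: "\<rho> (d \<cdot> \<pi>\<^sub>0 A A) = d \<cdot> \<pi>\<^sub>0 A A" "\<rho> (d \<cdot> \<pi>\<^sub>1 A A) = d \<cdot> \<pi>\<^sub>1 A A"
    and eq: "d' \<cdot> \<pi>\<^sub>0 A A = d \<cdot> \<pi>\<^sub>0 A A" "d' \<cdot> \<pi>\<^sub>1 A A = d \<cdot> \<pi>\<^sub>1 A A" for d d'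
  proof -
    note [simp] = homD[OF d] homD[OF d']
    define e0 where "e0 = d \<cdot> \<pi>\<^sub>0 A A"
    define e1 where "e1 = d \<cdot> \<pi>\<^sub>1 A A"
    have [simp]: "e0 \<in> Arr C" "Dom C e0 = A" "Cod C e0 = A" "e1 \<in> Arr C" "Dom C e1 = A" "Cod C e1 = A"
      by (simp_all add: e0_def e1_def)
    have self: "decides C [A, A] d d" "decides C [A, A] d' d'"
      by (rule decides_self; use A d d' idem in \<open>simp add: eq\<close>)+
    have rst: "\<rho> d = d \<cdot> codiag C 2 A"
      using self by (simp add: decides_binary)
    have dec: "d \<cdot> (e0 \<boxplus> e1) = d"
      using decides_qproj(5)[OF d A A self(1)] by (simp add: e0_def e1_def)
    have eq': "d' \<cdot> \<pi>\<^sub>0 A A = e0" "d' \<cdot> \<pi>\<^sub>1 A A = e1" and idem': "\<rho> e0 = e0" "\<rho> e1 = e1"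
      by (simp_all add: e0_def e1_def eq idem)
    have "d' \<cdot> (\<pi>\<^sub>0 A A \<cdot> \<iota>\<^sub>0 A A) = e0 \<cdot> \<iota>\<^sub>0 A A" "d' \<cdot> (\<pi>\<^sub>1 A A \<cdot> \<iota>\<^sub>1 A A) = e1 \<cdot> \<iota>\<^sub>1 A A"
      using Comp_assoc_Arr[of d' "\<pi>\<^sub>0 A A" "\<iota>\<^sub>0 A A"] Comp_assoc_Arr[of d' "\<pi>\<^sub>1 A A" "\<iota>\<^sub>1 A A"]
      by (simp_all add: eq' del: Comp_assoc_Arr)
    then have e: "e0 \<cdot> d' = e0 \<cdot> \<iota>\<^sub>0 A A" "e1 \<cdot> d' = e1 \<cdot> \<iota>\<^sub>1 A A"
      using decides_qproj(3,4)[OF d' A A self(2)] by (simp_all add: eq' idem')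
    have "\<rho> d \<cdot> d' = (d \<cdot> (e0 \<boxplus> e1)) \<cdot> codiag C 2 A \<cdot> d'"
      by (simp add: rst dec)
    also have "\<dots> = d \<cdot> cotuple C (A \<oplus> A) [e0 \<cdot> d', e1 \<cdot> d']"
      by (simp add: codiag_eq_copair copair_Comp)
    also have "\<dots> = d \<cdot> (e0 \<boxplus> e1)"
      by (simp add: e sum_map_eq_copair)
    finally show ?thesis
      by (simp add: rle_def dec)
  qed
  show ?thesis
    by (rule rle_antisym; rule le; use assms in simp)
qed

text \<open>The decisions of \<open>h\<close> and \<open>k\<close> have as components the domains of
  the components of \<open>h\<close> and \<open>k\<close>, so they coincide by
  \<open>decision_unique\<close>; each map is then recovered from its decision and its
  components.\<close>

lemma qproj_jointly_monic:
  assumes h: "h \<in> hom C A (B \<oplus> D)" and k: "k \<in> hom C A (B \<oplus> D)"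
    and BD: "B \<in> Obj C" "D \<in> Obj C"
    and eq: "h \<cdot> \<pi>\<^sub>0 B D = k \<cdot> \<pi>\<^sub>0 B D" "h \<cdot> \<pi>\<^sub>1 B D = k \<cdot> \<pi>\<^sub>1 B D"
  shows "h = k"
proof -
  note [simp] = homD[OF h] homD[OF k] BD
  obtain d d' where d: "decides C [B, D] h d" and d': "decides C [B, D] k d'"
    using decides_exists[OF h BD] decides_exists[OF k BD] by auto
  then have d_hom: "d \<in> hom C A (A \<oplus> A)" and d'_hom: "d' \<in> hom C A (A \<oplus> A)"
    by (simp_all add: decides_binary)
  note dq = decides_qproj[OF h BD d] and dq' = decides_qproj[OF k BD d']
  have dd': "d = d'"
    by (rule decision_unique[of A])
      (use d_hom d'_hom in \<open>simp_all add: dq(1,2) dq'(1,2) eq\<close>)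
  have "h = d \<cdot> (h \<cdot> \<pi>\<^sub>0 B D \<boxplus> h \<cdot> \<pi>\<^sub>1 B D)"
    by (rule dq(5)[symmetric])
  also have "\<dots> = d' \<cdot> (k \<cdot> \<pi>\<^sub>0 B D \<boxplus> k \<cdot> \<pi>\<^sub>1 B D)"
    by (simp only: dd' eq)
  also have "\<dots> = k"
    by (rule dq'(5))
  finally show ?thesis .
qed

text \<open>A map whose components are restriction idempotents decides itself, and by joint monicity
  nothing else decides it, so \<open>dec\<close> returns it. Separation thereby becomes a condition
  on components alone.\<close>

lemma separates_iff:
  assumes "f \<in> Arr C" "g \<in> Arr C" "Dom C f = A" "Dom C g = A"
  shows "separates C f g d \<longleftrightarrow> d \<in> hom C A (A \<oplus> A) \<and> d \<cdot> \<pi>\<^sub>0 A A = \<rho> f \<and> d \<cdot> \<pi>\<^sub>1 A A = \<rho> g"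
proof -
  have A [simp]: "A \<in> Obj C"
    using assms(1,3) by auto
  have "dec C [A, A] d = d" if d: "d \<in> hom C A (A \<oplus> A)" "d \<cdot> \<pi>\<^sub>0 A A = \<rho> f" "d \<cdot> \<pi>\<^sub>1 A A = \<rho> g"
  proof -
    have self: "decides C [A, A] d d"
      by (rule decides_self) (use assms d in simp_all)
    have "d' = d" if d': "decides C [A, A] d d'" for d'
      by (rule qproj_jointly_monic[of _ A A A])
        (use decides_qproj(1,2)[OF d(1) A A d'] d' d homD[OF d(1)] assms in
          \<open>simp_all add: decides_binary\<close>)
    with self show ?thesis
      unfolding dec_def by (rule the_equality)
  qed
  then show ?thesis
    using assms by (auto simp: separates_def decision_def numeral_2_eq_2)
qed

section \<open>Separation and joins through representing maps\<close>

text \<open>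
  The decisions in the definitions of \<open>\<bottom>\<close>, rows and joins can be replaced by arbitrary maps into a
  coproduct with the given components, which are determined by these.
\<close>

lemma perp_row_join:
  assumes h: "h \<in> hom C A (B \<oplus> D)" and BD: "B \<in> Obj C" "D \<in> Obj C"
    and f: "h \<cdot> \<pi>\<^sub>0 B D = f" and g: "h \<cdot> \<pi>\<^sub>1 B D = g"
  shows "f \<bottom> g" "row C f g = h" "D = B \<Longrightarrow> f \<squnion> g = h \<cdot> codiag C 2 B"
proof -
  note [simp] = homD[OF h] BD
  have fg [simp]: "f \<in> Arr C" "g \<in> Arr C" "Dom C f = A" "Dom C g = A" "Cod C f = B" "Cod C g = D"
    by (auto simp flip: f g)
  \<comment> \<open>The decision of \<open>h\<close> has the components \<open>\<rho> f\<close> and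
    \<open>\<rho> g\<close>, so it is the one that the definition of separation asks for.\<close>
  obtain d where d: "decides C [B, D] h d"
    using decides_exists[OF h] by auto
  have sep: "separates C f g d"
    by (subst separates_iff[of _ _ A])
      (use decides_qproj(1,2)[OF h BD d] d f g in \<open>simp_all add: decides_binary\<close>)
  then show "f \<bottom> g"
    unfolding perp_d_def by auto
  have "d' = d" if "separates C f g d'" for d'
    by (rule qproj_jointly_monic[of _ A A A]) (use that sep separates_iff[OF fg(1-4)] in simp_all)
  with sep have "sep C f g = d"
    unfolding sep_def by (rule the_equality)
  then show row: "row C f g = h"
    using decides_qproj(5)[OF h BD d] f g by (simp add: row_def)
  then show "f \<squnion> g = h \<cdot> codiag C 2 B"
    by (simp add: djoin_def row_def)
qed

text \<open>The representing map is \<open>d \<cdot> (f \<boxplus> g)\<close> for a separating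
  decision \<open>d\<close>; its components are \<open>\<rho> f \<cdot> f\<close> and
  \<open>\<rho> g \<cdot> g\<close>.\<close>

lemma perpE:
  assumes "f \<bottom> g" "f \<in> hom C A B" "g \<in> hom C A D"
  obtains h where "h \<in> hom C A (B \<oplus> D)" "h \<cdot> \<pi>\<^sub>0 B D = f" "h \<cdot> \<pi>\<^sub>1 B D = g"
proof -
  note [simp] = homD[OF assms(2)] homD[OF assms(3)]
  obtain d where "separates C f g d"
    using assms(1) by (auto simp: perp_d_def)
  then have d: "d \<in> hom C A (A \<oplus> A)" and q: "d \<cdot> \<pi>\<^sub>0 A A = \<rho> f" "d \<cdot> \<pi>\<^sub>1 A A = \<rho> g"
    by (simp_all add: separates_iff[of _ _ A])
  note [simp] = homD[OF d]
  have "d \<cdot> \<pi>\<^sub>0 A A \<cdot> f = f" "d \<cdot> \<pi>\<^sub>1 A A \<cdot> g = g"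
    by (simp_all add: q del: Comp_assoc_Arr)
  then show ?thesis
    by (intro that[of "d \<cdot> (f \<boxplus> g)"]) (simp_all add: homI)
qed

text \<open>Following the representing map by the symmetry exchanges its components, and the
  codiagonal absorbs the symmetry.\<close>

lemma perp_sym:
  assumes "f \<bottom> g" "f \<in> hom C A B" "g \<in> hom C A D"
  shows "g \<bottom> f" "D = B \<Longrightarrow> f \<squnion> g = g \<squnion> f"
proof -
  note [simp] = homD[OF assms(2)] homD[OF assms(3)]
  obtain h where h: "h \<in> hom C A (B \<oplus> D)" and q: "h \<cdot> \<pi>\<^sub>0 B D = f" "h \<cdot> \<pi>\<^sub>1 B D = g"
    using assms by (rule perpE)
  note [simp] = homD[OF h]
  have s: "symm C B D \<in> hom C (B \<oplus> D) (D \<oplus> B)"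
    "symm C B D \<cdot> \<pi>\<^sub>0 D B = \<pi>\<^sub>1 B D" "symm C B D \<cdot> \<pi>\<^sub>1 D B = \<pi>\<^sub>0 B D"
    by (simp_all add: symm_def homI copair_Comp) (simp_all add: qproj_eq_copair)
  note [simp] = homD[OF s(1)]
  have hs: "h \<cdot> symm C B D \<in> hom C A (D \<oplus> B)"
    "h \<cdot> symm C B D \<cdot> \<pi>\<^sub>0 D B = g" "h \<cdot> symm C B D \<cdot> \<pi>\<^sub>1 D B = f"
    by (simp_all add: homI s(2,3) q)
  show "g \<bottom> f"
    by (rule perp_row_join[OF hs(1) _ _ hs(2,3)]) simp_all
  assume D: "D = B"
  have "f \<squnion> g = h \<cdot> codiag C 2 B"
    by (rule perp_row_join(3)[OF h _ _ q D]) simp_all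
  also have "\<dots> = h \<cdot> (symm C B B \<cdot> codiag C 2 B)"
    by (simp add: symm_def codiag_eq_copair copair_Comp)
  also have "\<dots> = h \<cdot> symm C B D \<cdot> codiag C 2 D"
    using homD[OF h] homD[OF s(1)] by (simp add: D)
  also have "\<dots> = g \<squnion> f"
    by (rule perp_row_join(3)[OF hs(1) _ _ hs(2,3) D[symmetric], symmetric]) simp_all
  finally show "f \<squnion> g = g \<squnion> f" .
qed

lemma perp_Comp_right:
  assumes "f \<bottom> g" "f \<in> hom C A B" "g \<in> hom C A D" "a \<in> hom C B B'" "b \<in> hom C D D'"
  shows "f \<cdot> a \<bottom> g \<cdot> b"
proof -
  note [simp] = homD[OF assms(2)] homD[OF assms(3)] homD[OF assms(4)] homD[OF assms(5)]
  obtain h where h: "h \<in> hom C A (B \<oplus> D)" and q: "h \<cdot> \<pi>\<^sub>0 B D = f" "h \<cdot> \<pi>\<^sub>1 B D = g"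
    using assms(1-3) by (rule perpE)
  note [simp] = homD[OF h]
  have "h \<cdot> \<pi>\<^sub>0 B D \<cdot> a \<bottom> h \<cdot> \<pi>\<^sub>1 B D \<cdot> b"
    by (rule perp_row_join(1)[of "h \<cdot> (a \<boxplus> b)" A B' D']) (simp_all add: homI)
  then show ?thesis
    unfolding q .
qed

lemma join_Comp_left:
  assumes "f \<bottom> g" "f \<in> hom C A B" "g \<in> hom C A B" "k \<in> hom C E A"
  shows "k \<cdot> (f \<squnion> g) = k \<cdot> f \<squnion> k \<cdot> g"
proof -
  note [simp] = homD[OF assms(2)] homD[OF assms(3)] homD[OF assms(4)]
  obtain h where h: "h \<in> hom C A (B \<oplus> B)" and q: "h \<cdot> \<pi>\<^sub>0 B B = f" "h \<cdot> \<pi>\<^sub>1 B B = g"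
    using assms(1-3) by (rule perpE)
  note [simp] = homD[OF h]
  have "k \<cdot> f \<squnion> k \<cdot> g = (k \<cdot> h) \<cdot> codiag C 2 B"
    by (rule perp_row_join(3)[of "k \<cdot> h" E]) (simp_all add: homI q)
  also have "\<dots> = k \<cdot> (f \<squnion> g)"
    using perp_row_join(3)[OF h _ _ q] by simp
  finally show ?thesis ..
qed

text \<open>A row times a column: \<open>h \<cdot> (a \<boxplus> b)\<close> represents the two
  composites. The fixpoint equation, the diagonal axiom and the trace formula are all translated
  into components through this identity.\<close>

lemma row_Comp_copair:
  assumes "h \<in> hom C A (B \<oplus> D)" "a \<in> hom C B E" "b \<in> hom C D E"
  shows "h \<cdot> cotuple C E [a, b] = h \<cdot> \<pi>\<^sub>0 B D \<cdot> a \<squnion> h \<cdot> \<pi>\<^sub>1 B D \<cdot> b"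
proof -
  note [simp] = assms[THEN homD]
  have "h \<cdot> \<pi>\<^sub>0 B D \<cdot> a \<squnion> h \<cdot> \<pi>\<^sub>1 B D \<cdot> b = h \<cdot> (a \<boxplus> b) \<cdot> codiag C 2 E"
    by (rule perp_row_join(3)[of _ A]) (simp_all add: homI)
  then show ?thesis
    by (simp add: sum_map_codiag)
qed

lemma join_Comp_right:
  assumes "f \<bottom> g" "f \<in> hom C A B" "g \<in> hom C A B" "k \<in> hom C B E"
  shows "(f \<squnion> g) \<cdot> k = f \<cdot> k \<squnion> g \<cdot> k"
proof -
  note [simp] = homD[OF assms(2)] homD[OF assms(3)] homD[OF assms(4)]
  obtain h where h: "h \<in> hom C A (B \<oplus> B)" and q: "h \<cdot> \<pi>\<^sub>0 B B = f" "h \<cdot> \<pi>\<^sub>1 B B = g"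
    using assms(1-3) by (rule perpE)
  note [simp] = homD[OF h]
  have "(f \<squnion> g) \<cdot> k = h \<cdot> (codiag C 2 B \<cdot> k)"
    using perp_row_join(3)[OF h _ _ q] by simp
  also have "codiag C 2 B \<cdot> k = cotuple C E [k, k]"
    by (simp add: codiag_eq_copair copair_Comp)
  also have "h \<cdot> cotuple C E [k, k] = h \<cdot> \<pi>\<^sub>0 B B \<cdot> k \<squnion> h \<cdot> \<pi>\<^sub>1 B B \<cdot> k"
    by (rule row_Comp_copair[OF h assms(4,4)])
  finally show ?thesis
    unfolding q .
qed

lemma join_Zero:
  assumes "f \<in> hom C A B"
  shows "f \<squnion> Zero C A B = f"
proof -
  note [simp] = homD[OF assms]
  have "f \<squnion> Zero C A B = f \<cdot> \<iota>\<^sub>0 B B \<cdot> codiag C 2 B"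
    by (rule perp_row_join(3)[of _ A]) (simp_all add: homI)
  then show ?thesis
    by simp
qed

text \<open>On the domain of \<open>f\<close>, a map \<open>h\<close> representing the pair lands in
  the first summand, \<open>\<rho> f \<cdot> h = f \<cdot> \<iota>\<^sub>0 B D\<close>, so its
  second component vanishes there.\<close>

lemma perp_Rst_Comp:
  assumes "f \<bottom> g" "f \<in> hom C A B" "g \<in> hom C A D"
  shows "\<rho> f \<cdot> g = Zero C A D"
proof -
  note [simp] = homD[OF assms(2)] homD[OF assms(3)]
  obtain h where h: "h \<in> hom C A (B \<oplus> D)" and q: "h \<cdot> \<pi>\<^sub>0 B D = f" "h \<cdot> \<pi>\<^sub>1 B D = g"
    using assms by (rule perpE)
  note [simp] = homD[OF h]
  obtain d where "decides C [B, D] h d"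
    using decides_exists[OF h] by auto
  from decides_qproj(3)[OF h _ _ this] have "\<rho> f \<cdot> h = h \<cdot> (\<pi>\<^sub>0 B D \<cdot> \<iota>\<^sub>0 B D)"
    by (simp add: q)
  also have "\<dots> = f \<cdot> \<iota>\<^sub>0 B D"
    using Comp_assoc_Arr[of h "\<pi>\<^sub>0 B D" "\<iota>\<^sub>0 B D"] by (simp add: q del: Comp_assoc_Arr)
  finally have *: "\<rho> f \<cdot> h = f \<cdot> \<iota>\<^sub>0 B D" .
  have "\<rho> f \<cdot> g = \<rho> f \<cdot> h \<cdot> \<pi>\<^sub>1 B D"
    by (simp add: q)
  then show ?thesis
    unfolding * by simp
qed

end

section \<open>Kleene upper-stars\<close>

context classical_extensive_restriction_category
begin

text \<open>On the domain of \<open>h\<close> the map \<open>f\<close> vanishes, so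
  \<open>\<rho> h \<cdot> g = \<rho> h \<cdot> l\<close> for every complement \<open>l\<close> of
  \<open>f\<close> in \<open>g\<close>. Taking \<open>h\<close> and \<open>k\<close> for
  \<open>l\<close> gives \<open>\<rho> h \<cdot> k = h\<close>; used in both directions this makes
  complements unique.\<close>

lemma rel_compl_le:
  assumes "is_rel_compl C g f h" "is_rel_compl C g f k" "f \<sqsubseteq> g"
  shows "h \<sqsubseteq> k"
proof -
  have [simp]: "f \<in> Arr C" "g \<in> Arr C" "Dom C f = Dom C g" "Cod C f = Cod C g"
    using assms(3) by (simp_all add: rle_def)
  have h: "h \<in> hom C (Dom C g) (Cod C g)" "h \<bottom> f" "h \<squnion> f = g"
    and k: "k \<in> hom C (Dom C g) (Cod C g)" "k \<bottom> f" "k \<squnion> f = g"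
    using assms(1,2) by (simp_all add: is_rel_compl_def)
  note [simp] = homD[OF h(1)] homD[OF k(1)]
  have "\<rho> h \<cdot> g = \<rho> h \<cdot> l" if l: "l \<in> hom C (Dom C g) (Cod C g)" "l \<bottom> f" "l \<squnion> f = g" for l
  proof -
    note [simp] = homD[OF l(1)]
    have "\<rho> h \<cdot> (l \<squnion> f) = \<rho> h \<cdot> l \<squnion> \<rho> h \<cdot> f"
      by (rule join_Comp_left[OF l(2,1), of _ "Dom C g"]) (simp_all add: homI)
    then show ?thesis
      by (simp add: l(3) perp_Rst_Comp[OF h(2,1), of "Cod C g"] join_Zero homI)
  qed
  from this[OF h] this[OF k] show ?thesis
    by (simp add: rle_def)
qed

lemma is_rel_compl_rel_compl:
  assumes "f \<sqsubseteq> g"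
  shows "is_rel_compl C g f (rel_compl C g f)"
proof -
  obtain h where h: "is_rel_compl C g f h"
    using classical[OF assms] by auto
  moreover have "k = h" if "is_rel_compl C g f k" for k
    using rel_compl_le[OF that h assms] rel_compl_le[OF h that assms] by (rule rle_antisym)
  ultimately show ?thesis
    unfolding rel_compl_def by (rule theI)
qed

lemma compl_Rst:
  assumes [simp]: "f \<in> Arr C"
  shows "compl C (\<rho> f) \<in> hom C (Dom C f) (Dom C f)" "compl C (\<rho> f) \<bottom> \<rho> f"
    "compl C (\<rho> f) \<squnion> \<rho> f = Ident C (Dom C f)"
proof -
  have "\<rho> f \<sqsubseteq> Ident C (Dom C f)"
    by (simp add: rle_def)
  from is_rel_compl_rel_compl[OF this]
  show "compl C (\<rho> f) \<in> hom C (Dom C f) (Dom C f)" "compl C (\<rho> f) \<bottom> \<rho> f"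
    "compl C (\<rho> f) \<squnion> \<rho> f = Ident C (Dom C f)"
    by (simp_all add: is_rel_compl_def compl_def)
qed

text \<open>Split the identity into the domain of \<open>f\<close> and its complement and distribute
  over \<open>g\<close>: the part on the domain of \<open>f\<close> is zero by separation.\<close>

lemma compl_Rst_Comp:
  assumes "f \<bottom> g" "f \<in> hom C A B" "g \<in> hom C A D"
  shows "compl C (\<rho> f) \<cdot> g = g"
proof -
  note [simp] = homD[OF assms(2)] homD[OF assms(3)]
  note c = compl_Rst[of f, simplified]
  note [simp] = homD[OF c(1)]
  have "g = (compl C (\<rho> f) \<squnion> \<rho> f) \<cdot> g"
    by (simp add: c)
  also have "\<dots> = compl C (\<rho> f) \<cdot> g \<squnion> \<rho> f \<cdot> g"
    by (rule join_Comp_right[OF c(2,1) _ assms(3)]) (simp_all add: homI)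
  also have "\<dots> = compl C (\<rho> f) \<cdot> g"
    by (simp add: perp_Rst_Comp[OF assms] join_Zero homI)
  finally show ?thesis ..
qed

end

context kleene_upper_star
begin

lemma star_simps [simp]:
  assumes "f \<in> Arr C" "Cod C f = Dom C f"
  shows "star f \<in> Arr C" "Dom C (star f) = Dom C f" "Cod C (star f) = Dom C f"
  using star_hom[of f "Dom C f"] assms by (simp_all add: hom_def)

text \<open>The fixpoint equation in components. The axiom \<open>star1\<close> lists the exit
  first, whereas the row of \<open>f\<close> and \<open>g\<close> lists the loop first; hence the
  final commutation of the join.\<close>

lemma star_unfold:
  assumes "f \<in> hom C X X" "g \<in> hom C X A" "f \<bottom> g"
  shows "star f \<cdot> g = f \<cdot> star f \<cdot> g \<squnion> g"
proof -
  note [simp] = homD[OF assms(1)] homD[OF assms(2)]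
  let ?c = "compl C (\<rho> f)"
  note c = compl_Rst[of f, simplified]
  note [simp] = homD[OF c(1)]
  \<comment> \<open>The complement is known to be separated from \<open>\<rho> f\<close>; as
    \<open>f \<cdot> star f\<close> factors through \<open>\<rho> f\<close>, postcomposition extends
    this.\<close>
  have "?c \<cdot> Ident C X \<bottom> \<rho> f \<cdot> (f \<cdot> star f)"
    by (rule perp_Comp_right[OF c(2,1), of X _ X _ X]) (simp_all add: homI)
  then have perp: "?c \<bottom> f \<cdot> star f"
    by simp
  have "star f \<cdot> g = (?c \<squnion> f \<cdot> star f) \<cdot> g"
    by (simp only: star1[OF assms(1)])
  also have "\<dots> = ?c \<cdot> g \<squnion> f \<cdot> star f \<cdot> g"
    by (rule join_Comp_right[OF perp c(1) _ assms(2)]) (simp_all add: homI)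
  also have "?c \<cdot> g = g"
    by (rule compl_Rst_Comp[OF assms(3,1,2)])
  finally have *: "star f \<cdot> g = g \<squnion> f \<cdot> star f \<cdot> g" .
  have "f \<cdot> (star f \<cdot> g) \<bottom> g \<cdot> Ident C A"
    by (rule perp_Comp_right[OF assms(3,1,2), of _ A _ A]) (simp_all add: homI)
  then have "f \<cdot> star f \<cdot> g \<bottom> g"
    by simp
  then have "f \<cdot> star f \<cdot> g \<squnion> g = g \<squnion> f \<cdot> star f \<cdot> g"
    by (rule perp_sym(2)[of _ _ X A A]) (simp_all add: homI)
  with * show ?thesis
    by simp
qed

lemma star_iter_operator: "parametrized_iteration_operator C (star_iter C star)"
proof
  fix X A f
  assume [simp]: "X \<in> Obj C" "A \<in> Obj C" and f: "f \<in> hom C X (X \<oplus> A)"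
  note [simp] = homD[OF f]
  define f1 f2 where "f1 = f \<cdot> \<pi>\<^sub>0 X A" and "f2 = f \<cdot> \<pi>\<^sub>1 X A"
  have f1: "f1 \<in> hom C X X" and f2: "f2 \<in> hom C X A"
    by (simp_all add: f1_def f2_def homI)
  note [simp] = homD[OF f1] homD[OF f2]
  have iter: "star_iter C star X A f = star f1 \<cdot> f2"
    by (simp add: star_iter_def f1_def f2_def)
  show "star_iter C star X A f \<in> hom C X A"
    by (simp add: iter homI)
  have perp: "f1 \<bottom> f2"
    by (rule perp_row_join(1)[OF f]) (simp_all add: f1_def f2_def)
  have "f \<cdot> cotuple C A [star f1 \<cdot> f2, Ident C A] = f1 \<cdot> (star f1 \<cdot> f2) \<squnion> f2 \<cdot> Ident C A"
    using row_Comp_copair[OF f, of "star f1 \<cdot> f2" A "Ident C A"]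
    by (simp add: homI del: Comp_assoc_Arr flip: f1_def f2_def)
  also have "\<dots> = star f1 \<cdot> f2"
    using star_unfold[OF f1 f2 perp] by simp
  finally show "f \<cdot> copair C (star_iter C star X A f) (Ident C A) = star_iter C star X A f"
    by (simp add: iter)
next
  fix X A' f h A
  assume [simp]: "X \<in> Obj C" "A' \<in> Obj C" and f: "f \<in> hom C X (X \<oplus> A')" and h: "h \<in> hom C A' A"
  note [simp] = homD[OF f] homD[OF h]
  \<comment> \<open>Changing the exit by \<open>h\<close> leaves the loop component, and hence its
    star, untouched.\<close>
  show "star_iter C star X A (f \<cdot> (Ident C X \<boxplus> h)) = star_iter C star X A' f \<cdot> h"
    by (simp add: star_iter_def)
next
  fix X A f X' k
  assume [simp]: "X \<in> Obj C" "A \<in> Obj C" and f: "f \<in> hom C X' (X \<oplus> A)" and k: "k \<in> hom C X X'"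
  note [simp] = homD[OF f] homD[OF k]
  define f1 f2 where "f1 = f \<cdot> \<pi>\<^sub>0 X A" and "f2 = f \<cdot> \<pi>\<^sub>1 X A"
  have f1: "f1 \<in> hom C X' X" and f2: "f2 \<in> hom C X' A"
    by (simp_all add: f1_def f2_def homI)
  note [simp] = homD[OF f1] homD[OF f2]
  have perp: "f1 \<bottom> f2"
    by (rule perp_row_join(1)[OF f]) (simp_all add: f1_def f2_def)
  note c = compl_Rst(1)[of f1, simplified]
  note [simp] = homD[OF c]
  have "star_iter C star X A (k \<cdot> f) = star (k \<cdot> f1) \<cdot> k \<cdot> f2"
    by (simp add: star_iter_def f1_def f2_def)
  also have "\<dots> = k \<cdot> star (f1 \<cdot> k) \<cdot> compl C (\<rho> f1) \<cdot> f2"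
    by (simp only: star2[OF f1 k])
  also have "\<dots> = k \<cdot> (star (f1 \<cdot> k) \<cdot> f2)"
    by (simp add: compl_Rst_Comp[OF perp f1 f2])
  also have "star (f1 \<cdot> k) \<cdot> f2 = star_iter C star X' A (f \<cdot> (k \<boxplus> Ident C A))"
    by (simp add: star_iter_def f1_def f2_def)
  finally show "star_iter C star X A (k \<cdot> f) = k \<cdot> star_iter C star X' A (f \<cdot> (k \<boxplus> Ident C A))" .
next
  fix X A f
  assume [simp]: "X \<in> Obj C" "A \<in> Obj C" and f: "f \<in> hom C X (X \<oplus> X \<oplus> A)"
  note [simp] = homD[OF f]
  \<comment> \<open>Write \<open>f\<close> as the row of \<open>f1\<close>, \<open>f2\<close> and
    \<open>f3\<close>. The inner iteration is \<open>star f1 \<cdot> f'\<close>, so the outer one is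
    \<open>star (star f1 \<cdot> f2) \<cdot> (star f1 \<cdot> f3)\<close>; merging the loop summands
    first gives \<open>star (f1 \<squnion> f2) \<cdot> f3\<close>. The axiom \<open>star3\<close>
    equates the two.\<close>
  define f1 f' where "f1 = f \<cdot> \<pi>\<^sub>0 X (X \<oplus> A)" and "f' = f \<cdot> \<pi>\<^sub>1 X (X \<oplus> A)"
  have f1: "f1 \<in> hom C X X" and f': "f' \<in> hom C X (X \<oplus> A)"
    by (simp_all add: f1_def f'_def homI)
  note [simp] = homD[OF f1] homD[OF f']
  define f2 f3 where "f2 = f' \<cdot> \<pi>\<^sub>0 X A" and "f3 = f' \<cdot> \<pi>\<^sub>1 X A"
  have f2: "f2 \<in> hom C X X" and f3: "f3 \<in> hom C X A"
    by (simp_all add: f2_def f3_def homI)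
  note [simp] = homD[OF f2] homD[OF f3]
  have "f1 \<bottom> f'"
    by (rule perp_row_join(1)[OF f]) (simp_all add: f1_def f'_def)
  then have "f1 \<cdot> Ident C X \<bottom> f' \<cdot> \<pi>\<^sub>0 X A"
    by (rule perp_Comp_right[OF _ f1 f', of _ X _ X]) (simp_all add: homI)
  then have perp: "f1 \<bottom> f2"
    by (simp add: f2_def)
  let ?g = "assoc C X X A \<cdot> (codiag C 2 X \<boxplus> Ident C A)"
  have g0: "?g \<cdot> \<pi>\<^sub>0 X A = cotuple C X [Ident C X, \<pi>\<^sub>0 X A]"
    and g1: "?g \<cdot> \<pi>\<^sub>1 X A = \<pi>\<^sub>1 X (X \<oplus> A) \<cdot> \<pi>\<^sub>1 X A"
    by (simp_all add: assoc_def codiag_eq_copair qproj_eq_copair copair_Comp)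
  have "f \<cdot> (?g \<cdot> \<pi>\<^sub>0 X A) = f1 \<squnion> f2"
    unfolding g0 using row_Comp_copair[OF f, of "Ident C X" X "\<pi>\<^sub>0 X A"]
    by (simp add: homI f1_def f2_def f'_def)
  moreover have "f \<cdot> (?g \<cdot> \<pi>\<^sub>1 X A) = f3"
    unfolding g1 by (simp add: f3_def f'_def)
  ultimately have "star_iter C star X A (f \<cdot> ?g) = star (f1 \<squnion> f2) \<cdot> f3"
    by (simp add: star_iter_def)
  also have "\<dots> = star (star f1 \<cdot> f2) \<cdot> (star f1 \<cdot> f3)"
    by (simp add: star3[OF f1 f2 perp])
  also have "\<dots> = star_iter C star X A (star f1 \<cdot> f')"
    by (simp add: star_iter_def f2_def f3_def)
  also have "star f1 \<cdot> f' = star_iter C star X (X \<oplus> A) f"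
    by (simp add: star_iter_def f1_def f'_def)
  finally show "star_iter C star X A (star_iter C star X (X \<oplus> A) f) =
      star_iter C star X A (f \<cdot> assoc C X X A \<cdot> (codiag C 2 X \<boxplus> Ident C A))"
    by simp
qed

section \<open>The trace formula and its agreement with iteration\<close>

lemma star_trace_eq:
  assumes [simp]: "X \<in> Obj C" "A \<in> Obj C" "B \<in> Obj C" and g: "g \<in> hom C (X \<oplus> A) (X \<oplus> B)"
  shows "star_trace C star X A B g =
      \<iota>\<^sub>1 X A \<cdot> g \<cdot> cotuple C B [star_iter C star X B (\<iota>\<^sub>0 X A \<cdot> g), Ident C B]"
    "\<iota>\<^sub>1 X A \<cdot> g \<cdot> \<pi>\<^sub>1 X B \<bottom> \<iota>\<^sub>1 X A \<cdot> g \<cdot> \<pi>\<^sub>0 X B \<cdot> star (\<iota>\<^sub>0 X A \<cdot> g \<cdot> \<pi>\<^sub>0 X B) \<cdot> (\<iota>\<^sub>0 X A \<cdot> g \<cdot> \<pi>\<^sub>1 X B)"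
proof -
  note [simp] = homD[OF g]
  define k s where "k = \<iota>\<^sub>1 X A \<cdot> g" and "s = star_iter C star X B (\<iota>\<^sub>0 X A \<cdot> g)"
  have k: "k \<in> hom C A (X \<oplus> B)" and s: "s \<in> hom C X B"
    by (simp_all add: k_def s_def star_iter_def homI)
  note [simp] = homD[OF k] homD[OF s]
  have s_eq: "s = star (\<iota>\<^sub>0 X A \<cdot> g \<cdot> \<pi>\<^sub>0 X B) \<cdot> (\<iota>\<^sub>0 X A \<cdot> g \<cdot> \<pi>\<^sub>1 X B)"
    by (simp add: s_def star_iter_def)
  have "k \<cdot> \<pi>\<^sub>0 X B \<bottom> k \<cdot> \<pi>\<^sub>1 X B"
    by (rule perp_row_join(1)[OF k]) simp_all
  then have "k \<cdot> \<pi>\<^sub>0 X B \<cdot> s \<bottom> k \<cdot> \<pi>\<^sub>1 X B \<cdot> Ident C B"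
    by (rule perp_Comp_right[of _ _ A X B _ B _ B]) (simp_all add: homI)
  then have perp0: "k \<cdot> \<pi>\<^sub>0 X B \<cdot> s \<bottom> k \<cdot> \<pi>\<^sub>1 X B"
    by simp
  then have perp: "k \<cdot> \<pi>\<^sub>1 X B \<bottom> k \<cdot> \<pi>\<^sub>0 X B \<cdot> s"
    by (rule perp_sym(1)[of _ _ A B B]) (simp_all add: homI)
  have assoc: "k \<cdot> \<pi>\<^sub>0 X B \<cdot> star (\<iota>\<^sub>0 X A \<cdot> g \<cdot> \<pi>\<^sub>0 X B) \<cdot> (\<iota>\<^sub>0 X A \<cdot> g \<cdot> \<pi>\<^sub>1 X B) = k \<cdot> \<pi>\<^sub>0 X B \<cdot> s"
    unfolding s_eq by (rule Comp_assoc_Arr) simp_all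
  show "\<iota>\<^sub>1 X A \<cdot> g \<cdot> \<pi>\<^sub>1 X B \<bottom> \<iota>\<^sub>1 X A \<cdot> g \<cdot> \<pi>\<^sub>0 X B \<cdot> star (\<iota>\<^sub>0 X A \<cdot> g \<cdot> \<pi>\<^sub>0 X B) \<cdot> (\<iota>\<^sub>0 X A \<cdot> g \<cdot> \<pi>\<^sub>1 X B)"
    using perp unfolding assoc[symmetric] unfolding k_def .
  have "star_trace C star X A B g = k \<cdot> \<pi>\<^sub>1 X B \<squnion> k \<cdot> \<pi>\<^sub>0 X B \<cdot> s"
    unfolding assoc[symmetric] by (simp add: star_trace_def Let_def k_def del: Comp_assoc_Arr)
  also have "\<dots> = k \<cdot> \<pi>\<^sub>0 X B \<cdot> s \<squnion> k \<cdot> \<pi>\<^sub>1 X B"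
    by (rule perp_sym(2)[OF perp, of A B B]) (simp_all add: homI)
  also have "\<dots> = k \<cdot> cotuple C B [s, Ident C B]"
    using row_Comp_copair[OF k s, of "Ident C B"] by (simp add: homI)
  finally show "star_trace C star X A B g =
      \<iota>\<^sub>1 X A \<cdot> g \<cdot> cotuple C B [star_iter C star X B (\<iota>\<^sub>0 X A \<cdot> g), Ident C B]"
    by (simp only: k_def s_def)
qed

lemma star_trace_operator: "trace_operator C (star_trace C star)"
proof -
  interpret it: parametrized_iteration_operator C "star_iter C star"
    by (rule star_iter_operator)
  show ?thesis
    by (rule it.trace_operatorI) (rule star_trace_eq)
qed

lemma star_corresponding: "corresponding C (star_iter C star) (star_trace C star)"
proof -
  interpret it: parametrized_iteration_operator C "star_iter C star"
    by (rule star_iter_operator)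
  have "star_iter C star X B f = star_trace C star X X B (codiag C 2 X \<cdot> f)"
    if [simp]: "X \<in> Obj C" "B \<in> Obj C" and f: "f \<in> hom C X (X \<oplus> B)" for X B f
  proof -
    note [simp] = homD[OF f]
    \<comment> \<open>The codiagonal makes loop and input behave alike, so the trace is
      \<open>f\<close> unrolled once before its own iterate, and the fixpoint equation removes the
      unrolling.\<close>
    have "\<iota>\<^sub>0 X X \<cdot> (codiag C 2 X \<cdot> f) = f" "\<iota>\<^sub>1 X X \<cdot> (codiag C 2 X \<cdot> f) = f"
      by (simp_all add: codiag_eq_copair)
    moreover have "star_trace C star X X B (codiag C 2 X \<cdot> f) =
        \<iota>\<^sub>1 X X \<cdot> (codiag C 2 X \<cdot> f) \<cdot>
          cotuple C B [star_iter C star X B (\<iota>\<^sub>0 X X \<cdot> (codiag C 2 X \<cdot> f)), Ident C B]"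
      by (rule star_trace_eq) (simp_all add: homI)
    ultimately show ?thesis
      by (simp add: it.Iter_fixpoint del: Comp_assoc_Arr)
  qed
  moreover have "star_trace C star X A B f =
      Inj C [X, A] 1 \<cdot> f \<cdot> copair C (star_iter C star X B (Inj C [X, A] 0 \<cdot> f)) (Ident C B)"
    if "X \<in> Obj C" "A \<in> Obj C" "B \<in> Obj C" "f \<in> hom C (X \<oplus> A) (X \<oplus> B)" for X A B f
    using star_trace_eq(1)[OF that] that homD[OF that(4)] by (simp del: Comp_assoc_Arr)
  ultimately show ?thesis
    unfolding corresponding_def by blast
qed

text \<open>The row of a separated pair is its representing map, so its components are
  \<open>f1\<close> and \<open>f2\<close> again; this turns the definition through quasi-projections
  into the formula on rows.\<close>

lemma star_iter_row:
  assumes "f1 \<in> hom C X X" "f2 \<in> hom C X A" "f1 \<bottom> f2"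
  shows "row C f1 f2 \<in> hom C X (X \<oplus> A)" "star_iter C star X A (row C f1 f2) = star f1 \<cdot> f2"
proof -
  obtain h where h: "h \<in> hom C X (X \<oplus> A)" "h \<cdot> \<pi>\<^sub>0 X A = f1" "h \<cdot> \<pi>\<^sub>1 X A = f2"
    using assms by (auto elim: perpE)
  then have "row C f1 f2 = h"
    using homD[OF assms(1)] homD[OF assms(2)] by (intro perp_row_join(2)) auto
  with h show "row C f1 f2 \<in> hom C X (X \<oplus> A)" "star_iter C star X A (row C f1 f2) = star f1 \<cdot> f2"
    by (simp_all add: star_iter_def)
qed

end

theorem proposition9p13:
  fixes C :: "('o, 'm, 'x) rcat_scheme" (structure)
    and star :: "'m \<Rightarrow> 'm"
  assumes "extensive_restriction_category C"
    and "classical_extensive_restriction_category C"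
    and "kleene_upper_star C star"
  shows "parametrized_iteration_operator C (star_iter C star) \<and>
    traced_extensive_restriction_category C (star_trace C star) \<and>
    corresponding C (star_iter C star) (star_trace C star) \<and>
    (\<forall>X A f1 f2. f1 \<in> hom C X X \<and> f2 \<in> hom C X A \<and> f1 \<bottom> f2 \<longrightarrow>
       row C f1 f2 \<in> hom C X (X \<oplus> A) \<and>
       star_iter C star X A (row C f1 f2) = star f1 \<cdot> f2) \<and>
    (\<forall>X\<in>Obj C. \<forall>A\<in>Obj C. \<forall>B\<in>Obj C. \<forall>g \<in> hom C (X \<oplus> A) (X \<oplus> B).
       let g1 = Inj C [X, A] 0 \<cdot> g \<cdot> qproj C [X, B] 0;
           g2 = Inj C [X, A] 0 \<cdot> g \<cdot> qproj C [X, B] 1;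
           g3 = Inj C [X, A] 1 \<cdot> g \<cdot> qproj C [X, B] 0;
           g4 = Inj C [X, A] 1 \<cdot> g \<cdot> qproj C [X, B] 1
       in g4 \<bottom> g3 \<cdot> star g1 \<cdot> g2 \<and>
          star_trace C star X A B g = g4 \<squnion> g3 \<cdot> star g1 \<cdot> g2)"
proof -
  interpret kleene_upper_star C star
    by (rule assms)
  show ?thesis
    using star_iter_operator star_trace_operator star_corresponding star_iter_row star_trace_eq(2)
    by (simp add: traced_extensive_restriction_category_def assms(1) star_trace_def Let_def
        del: Comp_assoc_Arr)
qed

end
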